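(* Let $(\mathcal C,\otimes,\mathbf I,c)$ be a symmetric strict monoidal category, and let $H$ be an object of $\mathcal C$ endowed with a unital associative algebra structure $(\mu_H,\nu_H)$ and a counital coassociative coalgebra structure $(\Delta_H,\varepsilon_H)$, a priori not compatible. Let $(V_1,\dots,V_r)$ be a left-right Yetter-Drinfel'd system over $H$ in $\mathcal C$. Then a braiding (making $(V_1,\dots,V_r)$ a braided system in $\mathcal C$) can be defined by $$\sigma_{i,i}:=\nu_i\otimes\mu_i\ \text{ or }\ \mu_i\otimes\nu_i:V_i\otimes V_i\to V_i\otimes V_i,$$ $$\sigma_{i,j}:=c_{V_i,V_j}\circ(\mathrm{Id}_{V_i}\otimes\lambda_j)\circ(\delta_i\otimes\mathrm{Id}_{V_j}):V_i\otimes V_j\to V_j\otimes V_i,\qquad i<j.$$ The components $\sigma_{i,j}$ of this braiding with $i<j$ are invertible if $H$ is a Hopf algebra.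
   Context: Conventions. A left-right Yetter-Drinfel'd (YD) structure over $H$ on an object $V$ is a left $H$-module structure $\lambda:H\otimes V\to V$ and a right $H$-comodule structure $\delta:V\to V\otimes H$ such that $$(\mathrm{Id}_V\otimes\mu_H)(\delta\otimes\mathrm{Id}_H)c_{H,V}(\mathrm{Id}_H\otimes\lambda)(\Delta_H\otimes\mathrm{Id}_V)=(\lambda\otimes\mu_H)(\mathrm{Id}_H\otimes c_{H,V}\otimes\mathrm{Id}_H)(\Delta_H\otimes\delta).$$ A YD module algebra over $H$ is an object $V$ with a unital associative algebra structure $(\mu,\nu)$ and a YD structure $(\lambda,\delta)$ such that, with $\Delta_H^{op}=c_{H,H}\circ\Delta_H$: (a) $\delta\circ\mu=(\mu\otimes\mu_H)(\mathrm{Id}_V\otimes c_{H,V}\otimes\mathrm{Id}_H)(\delta\otimes\delta)$; (b) $\lambda(\mathrm{Id}_H\otimes\mu)=\mu(\lambda\otimes\lambda)(\mathrm{Id}_H\otimes c_{H,V}\otimes\mathrm{Id}_V)(\Delta_H^{op}\otimes\mathrm{Id}_{V\otimes V})$; (c) $\delta\circ\nu=\nu\otimes\nu_H$; (d) $\lambda(\mathrm{Id}_H\otimes\nu)=\varepsilon_H\otimes\nu$. An $H$-module algebra is the same without $\delta$ (algebra, left $H$-module, (b), (d)); an $H$-comodule algebra is the same without $\lambda$ (algebra, right $H$-comodule, (a), (c)). A (left-right) Yetter-Drinfel'd system over $H$ is an ordered finite family $V_1,\dots,V_r$ such that $(V_1,\mu_1,\nu_1,\delta_1)$ is an $H$-comodule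 algebra, $(V_r,\mu_r,\nu_r,\lambda_r)$ is an $H$-module algebra, and $(V_i,\mu_i,\nu_i,\lambda_i,\delta_i)$ is a YD module algebra over $H$ for all $1<i<r$. A braided system of rank $r$ in a monoidal category is an ordered family $V_1,\dots,V_r$ with morphisms (not necessarily invertible) $\sigma_{i,j}:V_i\otimes V_j\to V_j\otimes V_i$ for $1\le i\le j\le r$ (together called a braiding) satisfying, for all $1\le i\le j\le k\le r$, the colored Yang-Baxter equation on $V_i\otimes V_j\otimes V_k$: $$(\sigma_{j,k}\otimes\mathrm{Id}_i)(\mathrm{Id}_j\otimes\sigma_{i,k})(\sigma_{i,j}\otimes\mathrm{Id}_k)=(\mathrm{Id}_k\otimes\sigma_{i,j})(\sigma_{i,k}\otimes\mathrm{Id}_j)(\mathrm{Id}_i\otimes\sigma_{j,k}).$$ The choice in the definition of $\sigma_{i,i}$ can be made independently for each $i$. *)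

theory Defs
  imports Main
begin

record ('o, 'm) sym_mon_cat =
  obj :: "'o set"
  arr :: "'m set"
  source :: "'m \<Rightarrow> 'o"
  target :: "'m \<Rightarrow> 'o"
  ident :: "'o \<Rightarrow> 'm"  ("\<i>\<d>\<index>")
  compose :: "'m \<Rightarrow> 'm \<Rightarrow> 'm"  (infixr "\<cdot>\<index>" 65)
  unit_obj :: "'o"  ("\<one>\<index>")
  tensor_obj :: "'o \<Rightarrow> 'o \<Rightarrow> 'o"  (infixr "\<otimes>\<index>" 75)
  tensor_arr :: "'m \<Rightarrow> 'm \<Rightarrow> 'm"  (infixr "\<boxtimes>\<index>" 75)
  symm :: "'o \<Rightarrow> 'o \<Rightarrow> 'm"  ("\<c>\<index>")

definition hom :: "('o, 'm, 'x) sym_mon_cat_scheme \<Rightarrow> 'o \<Rightarrow> 'o \<Rightarrow> 'm set"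
  where "hom C A B = {f \<in> arr C. source C f = A \<and> target C f = B}"

definition invertible :: "('o, 'm, 'x) sym_mon_cat_scheme \<Rightarrow> 'm \<Rightarrow> bool"
  where "invertible C f \<longleftrightarrow> f \<in> arr C \<and>
    (\<exists>g \<in> hom C (target C f) (source C f).
      g \<cdot> f = \<i>\<d> (source C f) \<and> f \<cdot> g = \<i>\<d> (target C f))"
  for C (structure)

text \<open>
  Composition is written in applicative order (\<open>g \<cdot> f\<close> is \<open>g\<close> after \<open>f\<close>) and all structure maps are
  only constrained on the carriers \<open>obj C\<close> and \<open>arr C\<close>. Strictness means that the associativity and
  unit constraints are equalities, both on objects and on arrows. Of the two hexagons one suffices,
  the other one follows from \<open>symm_symm\<close>.
\<close>

locale sym_strict_monoidal_category =
  fixes C :: "('o, 'm, 'x) sym_mon_cat_scheme" (structure)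
  assumes source_obj: "f \<in> arr C \<Longrightarrow> source C f \<in> obj C"
    and target_obj: "f \<in> arr C \<Longrightarrow> target C f \<in> obj C"
    and ident_hom: "A \<in> obj C \<Longrightarrow> \<i>\<d> A \<in> hom C A A"
    and comp_hom: "\<lbrakk>f \<in> hom C A B; g \<in> hom C B D\<rbrakk> \<Longrightarrow> g \<cdot> f \<in> hom C A D"
    and ident_left: "f \<in> hom C A B \<Longrightarrow> \<i>\<d> B \<cdot> f = f"
    and ident_right: "f \<in> hom C A B \<Longrightarrow> f \<cdot> \<i>\<d> A = f"
    and comp_assoc: "\<lbrakk>f \<in> hom C A B; g \<in> hom C B D; h \<in> hom C D E\<rbrakk> \<Longrightarrow>
      (h \<cdot> g) \<cdot> f = h \<cdot> (g \<cdot> f)"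
    and unit_obj: "\<one> \<in> obj C"
    and tensor_obj: "\<lbrakk>A \<in> obj C; B \<in> obj C\<rbrakk> \<Longrightarrow> A \<otimes> B \<in> obj C"
    and tensor_hom: "\<lbrakk>f \<in> hom C A B; g \<in> hom C A' B'\<rbrakk> \<Longrightarrow>
      f \<boxtimes> g \<in> hom C (A \<otimes> A') (B \<otimes> B')"
    and tensor_ident: "\<lbrakk>A \<in> obj C; B \<in> obj C\<rbrakk> \<Longrightarrow> \<i>\<d> A \<boxtimes> \<i>\<d> B = \<i>\<d> (A \<otimes> B)"
    and interchange:
      "\<lbrakk>f \<in> hom C A B; g \<in> hom C B D; f' \<in> hom C A' B'; g' \<in> hom C B' D'\<rbrakk> \<Longrightarrow>
        (g \<cdot> f) \<boxtimes> (g' \<cdot> f') = (g \<boxtimes> g') \<cdot> (f \<boxtimes> f')"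
    and obj_assoc: "\<lbrakk>A \<in> obj C; B \<in> obj C; D \<in> obj C\<rbrakk> \<Longrightarrow> (A \<otimes> B) \<otimes> D = A \<otimes> (B \<otimes> D)"
    and obj_unit_left: "A \<in> obj C \<Longrightarrow> \<one> \<otimes> A = A"
    and obj_unit_right: "A \<in> obj C \<Longrightarrow> A \<otimes> \<one> = A"
    and arr_assoc: "\<lbrakk>f \<in> arr C; g \<in> arr C; h \<in> arr C\<rbrakk> \<Longrightarrow> (f \<boxtimes> g) \<boxtimes> h = f \<boxtimes> (g \<boxtimes> h)"
    and arr_unit_left: "f \<in> arr C \<Longrightarrow> \<i>\<d> \<one> \<boxtimes> f = f"
    and arr_unit_right: "f \<in> arr C \<Longrightarrow> f \<boxtimes> \<i>\<d> \<one> = f"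
    and symm_hom: "\<lbrakk>A \<in> obj C; B \<in> obj C\<rbrakk> \<Longrightarrow> \<c> A B \<in> hom C (A \<otimes> B) (B \<otimes> A)"
    and symm_natural: "\<lbrakk>f \<in> hom C A A'; g \<in> hom C B B'\<rbrakk> \<Longrightarrow>
      \<c> A' B' \<cdot> (f \<boxtimes> g) = (g \<boxtimes> f) \<cdot> \<c> A B"
    and symm_hexagon: "\<lbrakk>A \<in> obj C; B \<in> obj C; D \<in> obj C\<rbrakk> \<Longrightarrow>
      \<c> A (B \<otimes> D) = (\<i>\<d> B \<boxtimes> \<c> A D) \<cdot> (\<c> A B \<boxtimes> \<i>\<d> D)"
    and symm_symm: "\<lbrakk>A \<in> obj C; B \<in> obj C\<rbrakk> \<Longrightarrow> \<c> B A \<cdot> \<c> A B = \<i>\<d> (A \<otimes> B)"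

definition unital_algebra :: "('o, 'm, 'x) sym_mon_cat_scheme \<Rightarrow> 'o \<Rightarrow> 'm \<Rightarrow> 'm \<Rightarrow> bool"
  where "unital_algebra C V \<mu> \<nu> \<longleftrightarrow>
    V \<in> obj C \<and> \<mu> \<in> hom C (V \<otimes> V) V \<and> \<nu> \<in> hom C \<one> V \<and>
    \<mu> \<cdot> (\<mu> \<boxtimes> \<i>\<d> V) = \<mu> \<cdot> (\<i>\<d> V \<boxtimes> \<mu>) \<and>
    \<mu> \<cdot> (\<nu> \<boxtimes> \<i>\<d> V) = \<i>\<d> V \<and>
    \<mu> \<cdot> (\<i>\<d> V \<boxtimes> \<nu>) = \<i>\<d> V"
  for C (structure)

definition counital_coalgebra :: "('o, 'm, 'x) sym_mon_cat_scheme \<Rightarrow> 'o \<Rightarrow> 'm \<Rightarrow> 'm \<Rightarrow> bool"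
  where "counital_coalgebra C V \<Delta> \<epsilon> \<longleftrightarrow>
    V \<in> obj C \<and> \<Delta> \<in> hom C V (V \<otimes> V) \<and> \<epsilon> \<in> hom C V \<one> \<and>
    (\<Delta> \<boxtimes> \<i>\<d> V) \<cdot> \<Delta> = (\<i>\<d> V \<boxtimes> \<Delta>) \<cdot> \<Delta> \<and>
    (\<epsilon> \<boxtimes> \<i>\<d> V) \<cdot> \<Delta> = \<i>\<d> V \<and>
    (\<i>\<d> V \<boxtimes> \<epsilon>) \<cdot> \<Delta> = \<i>\<d> V"
  for C (structure)

definition bialgebra :: "('o, 'm, 'x) sym_mon_cat_scheme \<Rightarrow> 'o \<Rightarrow> 'm \<Rightarrow> 'm \<Rightarrow> 'm \<Rightarrow> 'm \<Rightarrow> bool"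
  where "bialgebra C H \<mu> \<nu> \<Delta> \<epsilon> \<longleftrightarrow>
    unital_algebra C H \<mu> \<nu> \<and> counital_coalgebra C H \<Delta> \<epsilon> \<and>
    \<Delta> \<cdot> \<mu> = (\<mu> \<boxtimes> \<mu>) \<cdot> (\<i>\<d> H \<boxtimes> \<c> H H \<boxtimes> \<i>\<d> H) \<cdot> (\<Delta> \<boxtimes> \<Delta>) \<and>
    \<Delta> \<cdot> \<nu> = \<nu> \<boxtimes> \<nu> \<and>
    \<epsilon> \<cdot> \<mu> = \<epsilon> \<boxtimes> \<epsilon> \<and>
    \<epsilon> \<cdot> \<nu> = \<i>\<d> \<one>"
  for C (structure)

definition hopf_algebra :: "('o, 'm, 'x) sym_mon_cat_scheme \<Rightarrow> 'o \<Rightarrow> 'm \<Rightarrow> 'm \<Rightarrow> 'm \<Rightarrow> 'm \<Rightarrow> bool"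
  where "hopf_algebra C H \<mu> \<nu> \<Delta> \<epsilon> \<longleftrightarrow>
    bialgebra C H \<mu> \<nu> \<Delta> \<epsilon> \<and>
    (\<exists>S \<in> hom C H H.
      \<mu> \<cdot> (S \<boxtimes> \<i>\<d> H) \<cdot> \<Delta> = \<nu> \<cdot> \<epsilon> \<and>
      \<mu> \<cdot> (\<i>\<d> H \<boxtimes> S) \<cdot> \<Delta> = \<nu> \<cdot> \<epsilon>)"
  for C (structure)

definition left_module ::
    "('o, 'm, 'x) sym_mon_cat_scheme \<Rightarrow> 'o \<Rightarrow> 'm \<Rightarrow> 'm \<Rightarrow> 'o \<Rightarrow> 'm \<Rightarrow> bool"
  where "left_module C H \<mu>H \<nu>H V lam \<longleftrightarrow>
    V \<in> obj C \<and> lam \<in> hom C (H \<otimes> V) V \<and>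
    lam \<cdot> (\<mu>H \<boxtimes> \<i>\<d> V) = lam \<cdot> (\<i>\<d> H \<boxtimes> lam) \<and>
    lam \<cdot> (\<nu>H \<boxtimes> \<i>\<d> V) = \<i>\<d> V"
  for C (structure)

definition right_comodule ::
    "('o, 'm, 'x) sym_mon_cat_scheme \<Rightarrow> 'o \<Rightarrow> 'm \<Rightarrow> 'm \<Rightarrow> 'o \<Rightarrow> 'm \<Rightarrow> bool"
  where "right_comodule C H \<Delta>H \<epsilon>H V \<delta> \<longleftrightarrow>
    V \<in> obj C \<and> \<delta> \<in> hom C V (V \<otimes> H) \<and>
    (\<delta> \<boxtimes> \<i>\<d> H) \<cdot> \<delta> = (\<i>\<d> V \<boxtimes> \<Delta>H) \<cdot> \<delta> \<and>
    (\<i>\<d> V \<boxtimes> \<epsilon>H) \<cdot> \<delta> = \<i>\<d> V"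
  for C (structure)

definition yd_structure ::
    "('o, 'm, 'x) sym_mon_cat_scheme \<Rightarrow> 'o \<Rightarrow> 'm \<Rightarrow> 'm \<Rightarrow> 'm \<Rightarrow> 'm \<Rightarrow> 'o \<Rightarrow> 'm \<Rightarrow> 'm \<Rightarrow> bool"
  where "yd_structure C H \<mu>H \<nu>H \<Delta>H \<epsilon>H V lam \<delta> \<longleftrightarrow>
    left_module C H \<mu>H \<nu>H V lam \<and> right_comodule C H \<Delta>H \<epsilon>H V \<delta> \<and>
    (\<i>\<d> V \<boxtimes> \<mu>H) \<cdot> (\<delta> \<boxtimes> \<i>\<d> H) \<cdot> \<c> H V \<cdot> (\<i>\<d> H \<boxtimes> lam) \<cdot> (\<Delta>H \<boxtimes> \<i>\<d> V) =
    (lam \<boxtimes> \<mu>H) \<cdot> (\<i>\<d> H \<boxtimes> \<c> H V \<boxtimes> \<i>\<d> H) \<cdot> (\<Delta>H \<boxtimes> \<delta>)"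
  for C (structure)

definition module_algebra ::
    "('o, 'm, 'x) sym_mon_cat_scheme \<Rightarrow> 'o \<Rightarrow> 'm \<Rightarrow> 'm \<Rightarrow> 'm \<Rightarrow> 'm \<Rightarrow> 'o \<Rightarrow> 'm \<Rightarrow> 'm \<Rightarrow> 'm \<Rightarrow> bool"
  where "module_algebra C H \<mu>H \<nu>H \<Delta>H \<epsilon>H V \<mu> \<nu> lam \<longleftrightarrow>
    unital_algebra C V \<mu> \<nu> \<and> left_module C H \<mu>H \<nu>H V lam \<and>
    lam \<cdot> (\<i>\<d> H \<boxtimes> \<mu>) =
      \<mu> \<cdot> (lam \<boxtimes> lam) \<cdot> (\<i>\<d> H \<boxtimes> \<c> H V \<boxtimes> \<i>\<d> V) \<cdot> ((\<c> H H \<cdot> \<Delta>H) \<boxtimes> \<i>\<d> (V \<otimes> V)) \<and>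
    lam \<cdot> (\<i>\<d> H \<boxtimes> \<nu>) = \<epsilon>H \<boxtimes> \<nu>"
  for C (structure)

definition comodule_algebra ::
    "('o, 'm, 'x) sym_mon_cat_scheme \<Rightarrow> 'o \<Rightarrow> 'm \<Rightarrow> 'm \<Rightarrow> 'm \<Rightarrow> 'm \<Rightarrow> 'o \<Rightarrow> 'm \<Rightarrow> 'm \<Rightarrow> 'm \<Rightarrow> bool"
  where "comodule_algebra C H \<mu>H \<nu>H \<Delta>H \<epsilon>H V \<mu> \<nu> \<delta> \<longleftrightarrow>
    unital_algebra C V \<mu> \<nu> \<and> right_comodule C H \<Delta>H \<epsilon>H V \<delta> \<and>
    \<delta> \<cdot> \<mu> = (\<mu> \<boxtimes> \<mu>H) \<cdot> (\<i>\<d> V \<boxtimes> \<c> H V \<boxtimes> \<i>\<d> H) \<cdot> (\<delta> \<boxtimes> \<delta>) \<and>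
    \<delta> \<cdot> \<nu> = \<nu> \<boxtimes> \<nu>H"
  for C (structure)

definition yd_module_algebra ::
    "('o, 'm, 'x) sym_mon_cat_scheme \<Rightarrow> 'o \<Rightarrow> 'm \<Rightarrow> 'm \<Rightarrow> 'm \<Rightarrow> 'm \<Rightarrow>
      'o \<Rightarrow> 'm \<Rightarrow> 'm \<Rightarrow> 'm \<Rightarrow> 'm \<Rightarrow> bool"
  where "yd_module_algebra C H \<mu>H \<nu>H \<Delta>H \<epsilon>H V \<mu> \<nu> lam \<delta> \<longleftrightarrow>
    yd_structure C H \<mu>H \<nu>H \<Delta>H \<epsilon>H V lam \<delta> \<and>
    module_algebra C H \<mu>H \<nu>H \<Delta>H \<epsilon>H V \<mu> \<nu> lam \<and>
    comodule_algebra C H \<mu>H \<nu>H \<Delta>H \<epsilon>H V \<mu> \<nu> \<delta>"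

text \<open>
  Families are functions on \<open>nat\<close> of which only the values at the indices \<open>1, \<dots>, r\<close> matter. For
  \<open>r > 1\<close> the values \<open>lam 1\<close> and \<open>\<delta> r\<close> are not constrained, as \<open>V 1\<close> carries no action and \<open>V r\<close> no
  coaction.
\<close>

definition yd_system ::
    "('o, 'm, 'x) sym_mon_cat_scheme \<Rightarrow> 'o \<Rightarrow> 'm \<Rightarrow> 'm \<Rightarrow> 'm \<Rightarrow> 'm \<Rightarrow> nat \<Rightarrow>
      (nat \<Rightarrow> 'o) \<Rightarrow> (nat \<Rightarrow> 'm) \<Rightarrow> (nat \<Rightarrow> 'm) \<Rightarrow> (nat \<Rightarrow> 'm) \<Rightarrow> (nat \<Rightarrow> 'm) \<Rightarrow> bool"
  where "yd_system C H \<mu>H \<nu>H \<Delta>H \<epsilon>H r V \<mu> \<nu> lam \<delta> \<longleftrightarrow>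
    1 \<le> r \<and>
    comodule_algebra C H \<mu>H \<nu>H \<Delta>H \<epsilon>H (V 1) (\<mu> 1) (\<nu> 1) (\<delta> 1) \<and>
    module_algebra C H \<mu>H \<nu>H \<Delta>H \<epsilon>H (V r) (\<mu> r) (\<nu> r) (lam r) \<and>
    (\<forall>i. 1 < i \<and> i < r \<longrightarrow>
      yd_module_algebra C H \<mu>H \<nu>H \<Delta>H \<epsilon>H (V i) (\<mu> i) (\<nu> i) (lam i) (\<delta> i))"

definition braided_system ::
    "('o, 'm, 'x) sym_mon_cat_scheme \<Rightarrow> nat \<Rightarrow> (nat \<Rightarrow> 'o) \<Rightarrow> (nat \<Rightarrow> nat \<Rightarrow> 'm) \<Rightarrow> bool"
  where "braided_system C r V \<sigma> \<longleftrightarrow>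
    (\<forall>i. 1 \<le> i \<and> i \<le> r \<longrightarrow> V i \<in> obj C) \<and>
    (\<forall>i j. 1 \<le> i \<and> i \<le> j \<and> j \<le> r \<longrightarrow> \<sigma> i j \<in> hom C (V i \<otimes> V j) (V j \<otimes> V i)) \<and>
    (\<forall>i j k. 1 \<le> i \<and> i \<le> j \<and> j \<le> k \<and> k \<le> r \<longrightarrow>
      (\<sigma> j k \<boxtimes> \<i>\<d> (V i)) \<cdot> (\<i>\<d> (V j) \<boxtimes> \<sigma> i k) \<cdot> (\<sigma> i j \<boxtimes> \<i>\<d> (V k)) =
      (\<i>\<d> (V k) \<boxtimes> \<sigma> i j) \<cdot> (\<sigma> i k \<boxtimes> \<i>\<d> (V j)) \<cdot> (\<i>\<d> (V i) \<boxtimes> \<sigma> j k))"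
  for C (structure)

end

theory Submission
  imports Defs
begin

text \<open>
  In Sweedler notation \<open>\<delta>(v) = v\<^sub>0 \<otimes> v\<^sub>1\<close> the braiding is \<open>\<sigma>(v \<otimes> w) = v\<^sub>1 w \<otimes> v\<^sub>0\<close>. Put
  \<open>d = c \<cdot> \<delta>\<close>, that is \<open>d(v) = v\<^sub>1 \<otimes> v\<^sub>0\<close>. Then \<open>\<sigma>\<close> depends only on \<open>d\<close> and on the action \<open>l\<close> of \<open>H\<close>
  on \<open>w\<close>: first \<open>d\<close> emits an element of \<open>H\<close> on the left of \<open>v\<close>, then \<open>v\<close> crosses \<open>w\<close>, then \<open>l\<close>
  absorbs that element into \<open>w\<close>. This construction, \<open>pairing\<close>, makes sense for any object in the place of
  \<open>H\<close>. It is natural in all its arguments, and two pairings that share a strand fuse to one pairing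
  over a tensor product (\<open>pairing_fuse_right\<close>, \<open>pairing_fuse_left\<close>).

  Fusion turns the colored Yang-Baxter equation on \<open>V\<^sub>i \<otimes> V\<^sub>j \<otimes> V\<^sub>k\<close> into a statement about one of
  the \<open>\<sigma>\<close>'s. If \<open>i < j\<close>, both crossings of \<open>V\<^sub>i\<close> fuse, by coassociativity of \<open>\<delta>\<^sub>i\<close>, to the pairing with the
  action \<open>h(v \<otimes> w) = h\<^sub>2 v \<otimes> h\<^sub>1 w\<close> on \<open>V\<^sub>j \<otimes> V\<^sub>k\<close>; so it suffices that \<open>\<sigma>\<^sub>j\<^sub>k\<close> is linear for this action
  (\<open>yang_baxter_if_linear\<close>). If \<open>i = j < k\<close>, both crossings of \<open>V\<^sub>k\<close> fuse, by associativity of the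
  action on \<open>V\<^sub>k\<close>, and it suffices that \<open>\<sigma>\<^sub>i\<^sub>i\<close> is colinear for the codiagonal coaction
  (\<open>yang_baxter_if_colinear\<close>).

  These conditions are exactly what the axioms provide. For \<open>j < k\<close>, linearity of \<open>\<sigma>\<^sub>j\<^sub>k\<close> follows from the
  Yetter-Drinfel'd condition on \<open>V\<^sub>j\<close> (\<open>pairing_linear_if_yd\<close>). Since \<open>\<sigma>\<^sub>i\<^sub>i\<close> is a tensor product of \<open>\<mu>\<^sub>i\<close>
  and \<open>\<nu>\<^sub>i\<close>, its linearity and colinearity follow from those of \<open>\<mu>\<^sub>i\<close> and \<open>\<nu>\<^sub>i\<close>, which are the
  compatibilities in a module algebra and in a comodule algebra. For \<open>i = j = k\<close> the equation involves
  the algebra \<open>V\<^sub>i\<close> alone (\<open>yang_baxter_algebra\<close>).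

  Finally, if \<open>S\<close> is an antipode, the inverse of \<open>\<sigma>\<close> is \<open>w \<otimes> v \<mapsto> v\<^sub>0 \<otimes> S(v\<^sub>1) w\<close>.
\<close>

section \<open>Whiskered arrows\<close>

context sym_strict_monoidal_category
begin

lemma hom_data:
  assumes "f \<in> hom C A B"
  shows "f \<in> arr C" "source C f = A" "target C f = B" "A \<in> obj C" "B \<in> obj C"
  using assms source_obj target_obj by (auto simp: hom_def)

lemma homI: "\<lbrakk>f \<in> arr C; source C f = A; target C f = B\<rbrakk> \<Longrightarrow> f \<in> hom C A B"
  by (simp add: hom_def)

declare source_obj [simp] target_obj [simp] unit_obj [simp] tensor_obj [simp]
  obj_assoc [simp] obj_unit_left [simp] obj_unit_right [simp]

lemma ident_data [simp]:
  assumes "A \<in> obj C"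
  shows "\<i>\<d> A \<in> arr C" "source C (\<i>\<d> A) = A" "target C (\<i>\<d> A) = A"
  using hom_data[OF ident_hom[OF assms]] by auto

lemma comp_data [simp]:
  assumes "f \<in> arr C" "g \<in> arr C" "target C f = source C g"
  shows "g \<cdot> f \<in> arr C" "source C (g \<cdot> f) = source C f" "target C (g \<cdot> f) = target C g"
  using hom_data[OF comp_hom[of f "source C f" "target C f" g "target C g"]] assms
  by (auto simp: hom_def)

lemma tensor_data [simp]:
  assumes "f \<in> arr C" "g \<in> arr C"
  shows "f \<boxtimes> g \<in> arr C" "source C (f \<boxtimes> g) = source C f \<otimes> source C g"
    "target C (f \<boxtimes> g) = target C f \<otimes> target C g"
  using hom_data[OF tensor_hom[of f "source C f" "target C f" g "source C g" "target C g"]] assms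
  by (auto simp: hom_def)

lemma symm_data [simp]:
  assumes "A \<in> obj C" "B \<in> obj C"
  shows "\<c> A B \<in> arr C" "source C (\<c> A B) = A \<otimes> B" "target C (\<c> A B) = B \<otimes> A"
  using hom_data[OF symm_hom[OF assms]] by auto

lemma ident_comp [simp]: "\<lbrakk>f \<in> arr C; A = target C f\<rbrakk> \<Longrightarrow> \<i>\<d> A \<cdot> f = f"
  using ident_left[of f "source C f" A] by (auto simp: hom_def)

lemma comp_ident [simp]: "\<lbrakk>f \<in> arr C; A = source C f\<rbrakk> \<Longrightarrow> f \<cdot> \<i>\<d> A = f"
  using ident_right[of f A "target C f"] by (auto simp: hom_def)

lemma comp_assoc_arr [simp]:
  "\<lbrakk>f \<in> arr C; g \<in> arr C; h \<in> arr C; target C f = source C g; target C g = source C h\<rbrakk> \<Longrightarrow>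
    (h \<cdot> g) \<cdot> f = h \<cdot> g \<cdot> f"
  by (rule comp_assoc) (auto simp: hom_def)

lemma interchange_arr:
  "\<lbrakk>f \<in> arr C; g \<in> arr C; f' \<in> arr C; g' \<in> arr C; target C f = source C g; target C f' = source C g'\<rbrakk>
    \<Longrightarrow> (g \<cdot> f) \<boxtimes> (g' \<cdot> f') = (g \<boxtimes> g') \<cdot> (f \<boxtimes> f')"
  by (rule interchange) (auto simp: hom_def)

text \<open>
  Diagrams are compared in a normal form: a composite of layers \<open>whisker A f B\<close>, each of which
  contains a single structure map \<open>f\<close>. Both identities are always present, with \<open>\<one>\<close> standing for an
  absent strand, so that one pattern covers every position of \<open>f\<close>. The simplifier produces this
  form; what then remains of an equation of diagrams is to move layers past each other.
\<close>

definition whisker :: "'o \<Rightarrow> 'm \<Rightarrow> 'o \<Rightarrow> 'm"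
  where "whisker A f B = \<i>\<d> A \<boxtimes> f \<boxtimes> \<i>\<d> B"

lemma whisker_data [simp]:
  assumes "A \<in> obj C" "f \<in> arr C" "B \<in> obj C"
  shows "whisker A f B \<in> arr C" "source C (whisker A f B) = A \<otimes> source C f \<otimes> B"
    "target C (whisker A f B) = A \<otimes> target C f \<otimes> B"
  using assms by (auto simp: whisker_def)

lemma ident_tensor [simp]: "\<lbrakk>A \<in> obj C; f \<in> arr C\<rbrakk> \<Longrightarrow> \<i>\<d> A \<boxtimes> f = whisker A f \<one>"
  by (simp add: whisker_def arr_unit_right)

lemma tensor_ident_right [simp]: "\<lbrakk>A \<in> obj C; f \<in> arr C\<rbrakk> \<Longrightarrow> f \<boxtimes> \<i>\<d> A = whisker \<one> f A"
  by (simp add: whisker_def arr_unit_left del: ident_tensor)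

lemma whisker_unit [simp]: "f \<in> arr C \<Longrightarrow> whisker \<one> f \<one> = f"
  by (simp add: whisker_def arr_unit_left arr_unit_right del: ident_tensor tensor_ident_right)

lemma whisker_ident [simp]:
  "\<lbrakk>A \<in> obj C; X \<in> obj C; B \<in> obj C\<rbrakk> \<Longrightarrow> whisker A (\<i>\<d> X) B = \<i>\<d> (A \<otimes> X \<otimes> B)"
  by (simp add: whisker_def tensor_ident del: ident_tensor tensor_ident_right)

lemma whisker_comp [simp]:
  assumes "A \<in> obj C" "f \<in> arr C" "g \<in> arr C" "target C f = source C g" "B \<in> obj C"
  shows "whisker A (g \<cdot> f) B = whisker A g B \<cdot> whisker A f B"
  using assms interchange_arr[of f g "\<i>\<d> B" "\<i>\<d> B"] interchange_arr[of "\<i>\<d> A" "\<i>\<d> A" "f \<boxtimes> \<i>\<d> B" "g \<boxtimes> \<i>\<d> B"]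
  by (simp add: whisker_def del: ident_tensor tensor_ident_right)

lemma whisker_whisker [simp]:
  assumes "A \<in> obj C" "A' \<in> obj C" "f \<in> arr C" "B' \<in> obj C" "B \<in> obj C"
  shows "whisker A (whisker A' f B') B = whisker (A \<otimes> A') f (B' \<otimes> B)"
  using assms
  by (simp add: whisker_def arr_assoc tensor_ident[symmetric] del: ident_tensor tensor_ident_right)

text \<open>
  A tensor product of two arrows has two layered forms, according to which factor acts last.
\<close>

lemma tensor_left_last:
  assumes "f \<in> arr C" "g \<in> arr C"
  shows "f \<boxtimes> g = whisker \<one> f (target C g) \<cdot> whisker (source C f) g \<one>"
  using assms interchange_arr[of "\<i>\<d> (source C f)" f g "\<i>\<d> (target C g)"] by simp

lemma tensor_left_first:
  assumes "f \<in> arr C" "g \<in> arr C"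
  shows "f \<boxtimes> g = whisker (target C f) g \<one> \<cdot> whisker \<one> f (source C g)"
  using assms interchange_arr[of f "\<i>\<d> (target C f)" "\<i>\<d> (source C g)" g] by simp

text \<open>
  Disjoint layers commute. As a rewrite rule this must be directed, and which direction brings the
  interacting layers together depends on the diagram. The proofs below therefore collect in \<open>eqs\<close>
  the instances that they use, each in its direction, along with naturality and the algebraic
  identities in whiskered form.
\<close>

lemma whisker_slide:
  assumes "A \<in> obj C" "f \<in> hom C X X'" "M \<in> obj C" "g \<in> hom C Y Y'" "B \<in> obj C"
  shows "whisker (A \<otimes> X' \<otimes> M) g B \<cdot> whisker A f (M \<otimes> Y \<otimes> B) =
    whisker A f (M \<otimes> Y' \<otimes> B) \<cdot> whisker (A \<otimes> X \<otimes> M) g B"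
proof -
  note [simp] = assms(1,3,5) hom_data[OF assms(2)] hom_data[OF assms(4)]
  have "whisker A (whisker X' (whisker M g B) \<one> \<cdot> whisker \<one> f (M \<otimes> Y \<otimes> B)) \<one> =
    whisker A (whisker \<one> f (M \<otimes> Y' \<otimes> B) \<cdot> whisker X (whisker M g B) \<one>) \<one>"
    using tensor_left_last[of f "whisker M g B"] tensor_left_first[of f "whisker M g B"]
    by simp
  then show ?thesis by (simp del: whisker_unit)
qed

text \<open>
  Composites are bracketed to the right. To rewrite the leading layers of a longer composite, an
  equation is needed in the form with an arbitrary remainder \<open>z\<close>.
\<close>

lemma comp_prefix_eq:
  assumes "g \<cdot> f = h" "f \<in> arr C" "g \<in> arr C" "target C f = source C g"
    "z \<in> arr C" "target C z = source C f"
  shows "g \<cdot> f \<cdot> z = h \<cdot> z"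
  using assms comp_assoc_arr[of z f g] by simp

lemma symm_natural_whisker:
  assumes "P \<in> obj C" "f \<in> hom C A A'" "B \<in> obj C" "Q \<in> obj C"
  shows "whisker P (\<c> A' B) Q \<cdot> whisker P f (B \<otimes> Q) = whisker (P \<otimes> B) f Q \<cdot> whisker P (\<c> A B) Q"
    "whisker P (\<c> B A') Q \<cdot> whisker (P \<otimes> B) f Q = whisker P f (B \<otimes> Q) \<cdot> whisker P (\<c> B A) Q"
proof -
  note [simp] = assms(1,3,4) hom_data[OF assms(2)]
  have 1: "\<c> A' B \<cdot> whisker \<one> f B = whisker B f \<one> \<cdot> \<c> A B"
    using symm_natural[OF assms(2) ident_hom[OF assms(3)]] by simp
  have 2: "\<c> B A' \<cdot> whisker B f \<one> = whisker \<one> f B \<cdot> \<c> B A"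
    using symm_natural[OF ident_hom[OF assms(3)] assms(2)] by simp
  show "whisker P (\<c> A' B) Q \<cdot> whisker P f (B \<otimes> Q) = whisker (P \<otimes> B) f Q \<cdot> whisker P (\<c> A B) Q"
    using arg_cong[OF 1, of "\<lambda>f. whisker P f Q"] by simp
  show "whisker P (\<c> B A') Q \<cdot> whisker (P \<otimes> B) f Q = whisker P f (B \<otimes> Q) \<cdot> whisker P (\<c> B A) Q"
    using arg_cong[OF 2, of "\<lambda>f. whisker P f Q"] by simp
qed

lemma symm_tensor_right:
  assumes "A \<in> obj C" "B \<in> obj C" "D \<in> obj C"
  shows "\<c> A (B \<otimes> D) = whisker B (\<c> A D) \<one> \<cdot> whisker \<one> (\<c> A B) D"
  using assms symm_hexagon by simp

lemma symm_symm_whisker: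
  assumes "P \<in> obj C" "A \<in> obj C" "B \<in> obj C" "Q \<in> obj C"
  shows "whisker P (\<c> B A) Q \<cdot> whisker P (\<c> A B) Q = \<i>\<d> (P \<otimes> A \<otimes> B \<otimes> Q)"
  using assms arg_cong[OF symm_symm[OF assms(2,3)], of "\<lambda>f. whisker P f Q"] by simp

section \<open>Coherence of the symmetry\<close>

text \<open>
  The second hexagon follows from the first one because both sides are inverse to \<open>\<c> D (A \<otimes> B)\<close>.
\<close>

lemma symm_tensor_left:
  assumes [simp]: "A \<in> obj C" "B \<in> obj C" "D \<in> obj C"
  shows "\<c> (A \<otimes> B) D = whisker \<one> (\<c> A D) B \<cdot> whisker A (\<c> B D) \<one>"
proof -
  let ?x = "whisker \<one> (\<c> A D) B \<cdot> whisker A (\<c> B D) \<one>"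
  have "?x \<cdot> \<c> D (A \<otimes> B) = whisker \<one> (\<c> A D) B \<cdot> whisker A (\<c> B D) \<one> \<cdot>
      whisker A (\<c> D B) \<one> \<cdot> whisker \<one> (\<c> D A) B"
    by (simp add: symm_tensor_right)
  also have "\<dots> = \<i>\<d> (D \<otimes> A \<otimes> B)"
    using symm_symm_whisker[of A D B \<one>] symm_symm_whisker[of \<one> D A B] by (simp add: comp_prefix_eq)
  finally have 1: "?x \<cdot> \<c> D (A \<otimes> B) = \<i>\<d> (D \<otimes> A \<otimes> B)" .
  have "?x = ?x \<cdot> \<c> D (A \<otimes> B) \<cdot> \<c> (A \<otimes> B) D"
    using symm_symm[of "A \<otimes> B" D] by simp
  also have "\<dots> = (?x \<cdot> \<c> D (A \<otimes> B)) \<cdot> \<c> (A \<otimes> B) D"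
    by simp
  also have "\<dots> = \<c> (A \<otimes> B) D" unfolding 1 by simp
  finally show ?thesis by simp
qed

text \<open>
  By the hexagon for \<open>\<one> \<otimes> \<one> = \<one>\<close> this arrow is idempotent, and it is invertible.
\<close>

lemma symm_unit_right [simp]:
  assumes [simp]: "A \<in> obj C" shows "\<c> A \<one> = \<i>\<d> A"
proof -
  have i: "\<c> A \<one> \<cdot> \<c> A \<one> = \<c> A \<one>" using symm_hexagon[of A \<one> \<one>] by simp
  have "\<c> A \<one> = \<c> \<one> A \<cdot> \<c> A \<one> \<cdot> \<c> A \<one>"
    using comp_prefix_eq[OF symm_symm[of A \<one>], of "\<c> A \<one>"] by simp
  then show ?thesis using symm_symm[of A \<one>] unfolding i by simp
qed

lemma symm_unit_left [simp]:
  assumes [simp]: "A \<in> obj C" shows "\<c> \<one> A = \<i>\<d> A"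
  using symm_symm[of A \<one>] by simp

section \<open>The pairing of a coaction with an action\<close>

text \<open>
  For \<open>d(v) = \<Sum> k \<otimes> v'\<close> in \<open>K \<otimes> V\<close> this is \<open>v \<otimes> w \<mapsto> \<Sum> l(k \<otimes> w) \<otimes> v'\<close>. The object \<open>K\<close> and the domains
  and codomains of \<open>d\<close> and \<open>l\<close> are arbitrary because fusion leads from \<open>H\<close> to \<open>H \<otimes> H\<close>, and
  naturality from a coaction or an action to its composites.
\<close>

definition pairing :: "'o \<Rightarrow> 'o \<Rightarrow> 'o \<Rightarrow> 'm \<Rightarrow> 'm \<Rightarrow> 'm"
  where "pairing K V W d l = whisker \<one> l V \<cdot> whisker K (\<c> V W) \<one> \<cdot> whisker \<one> d W"

lemma pairing_hom:
  assumes "K \<in> obj C" "V \<in> obj C" "W \<in> obj C" "d \<in> hom C A (K \<otimes> V)" "l \<in> hom C (K \<otimes> W) B"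
  shows "pairing K V W d l \<in> hom C (A \<otimes> W) (B \<otimes> V)"
proof -
  note [simp] = assms(1-3) hom_data[OF assms(4)] hom_data[OF assms(5)]
  show ?thesis by (rule homI) (simp_all add: pairing_def)
qed

lemma pairing_precomp_left:
  assumes "K \<in> obj C" "V \<in> obj C" "W \<in> obj C" "d \<in> hom C A (K \<otimes> V)" "l \<in> hom C (K \<otimes> W) B"
    "f \<in> hom C A' A"
  shows "pairing K V W (d \<cdot> f) l = pairing K V W d l \<cdot> whisker \<one> f W"
proof -
  note [simp] = assms(1-3) hom_data[OF assms(4)] hom_data[OF assms(5)] hom_data[OF assms(6)]
  show ?thesis by (simp add: pairing_def)
qed

lemma pairing_postcomp_left:
  assumes "K \<in> obj C" "W \<in> obj C" "d \<in> hom C A (K \<otimes> V)" "l \<in> hom C (K \<otimes> W) B"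
    "f \<in> hom C V V'"
  shows "pairing K V' W (whisker K f \<one> \<cdot> d) l = whisker B f \<one> \<cdot> pairing K V W d l"
proof -
  note [simp] = assms(1-2) hom_data[OF assms(3)] hom_data[OF assms(4)] hom_data[OF assms(5)]
  note eqs = symm_natural_whisker(1)[OF assms(1,5,2) unit_obj]
      whisker_slide[OF unit_obj assms(4) unit_obj assms(5) unit_obj]
  note eqs = eqs [simplified]
  show ?thesis by (simp add: pairing_def eqs eqs[THEN comp_prefix_eq])
qed

lemma pairing_precomp_right:
  assumes "K \<in> obj C" "V \<in> obj C" "d \<in> hom C A (K \<otimes> V)" "l \<in> hom C (K \<otimes> W) B"
    "g \<in> hom C W' W"
  shows "pairing K V W' d (l \<cdot> whisker K g \<one>) = pairing K V W d l \<cdot> whisker A g \<one>"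
proof -
  note [simp] = assms(1-2) hom_data[OF assms(3)] hom_data[OF assms(4)] hom_data[OF assms(5)]
  note eqs = symm_natural_whisker(2)[OF assms(1,5,2) unit_obj]
      whisker_slide[OF unit_obj assms(3) unit_obj assms(5) unit_obj, symmetric]
  note eqs = eqs [simplified]
  show ?thesis by (simp add: pairing_def eqs eqs[THEN comp_prefix_eq])
qed

lemma pairing_postcomp_right:
  assumes "K \<in> obj C" "V \<in> obj C" "W \<in> obj C" "d \<in> hom C A (K \<otimes> V)" "l \<in> hom C (K \<otimes> W) B"
    "g \<in> hom C B B'"
  shows "pairing K V W d (g \<cdot> l) = whisker \<one> g V \<cdot> pairing K V W d l"
proof -
  note [simp] = assms(1-3) hom_data[OF assms(4)] hom_data[OF assms(5)] hom_data[OF assms(6)]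
  show ?thesis by (simp add: pairing_def)
qed

text \<open>
  An arrow acting on the strand \<open>K\<close> may be counted as part of \<open>d\<close> or of \<open>l\<close>. With fusion this is
  the rule that brings in the coproduct and the product of \<open>H\<close>.
\<close>

lemma pairing_balanced:
  assumes "V \<in> obj C" "W \<in> obj C" "d \<in> hom C A (K \<otimes> V)" "l \<in> hom C (K' \<otimes> W) B"
    "k \<in> hom C K K'"
  shows "pairing K' V W (whisker \<one> k V \<cdot> d) l = pairing K V W d (l \<cdot> whisker \<one> k W)"
proof -
  note [simp] = assms(1-2) hom_data[OF assms(3)] hom_data[OF assms(4)] hom_data[OF assms(5)]
  note eqs = whisker_slide[OF unit_obj assms(5) unit_obj symm_hom[OF assms(1,2)] unit_obj]
  note eqs = eqs [simplified]
  show ?thesis by (simp add: pairing_def eqs eqs[THEN comp_prefix_eq])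
qed

text \<open>
  One strand \<open>A\<close> crosses \<open>W\<^sub>1\<close> and then \<open>W\<^sub>2\<close>. The second emission slides back before the
  first crossing, after which the two crossings are one by the hexagon.
\<close>

lemma pairing_fuse_right:
  assumes "K\<^sub>1 \<in> obj C" "K\<^sub>2 \<in> obj C" "V\<^sub>1 \<in> obj C" "V\<^sub>2 \<in> obj C" "W\<^sub>1 \<in> obj C" "W\<^sub>2 \<in> obj C"
    "d\<^sub>1 \<in> hom C A (K\<^sub>1 \<otimes> V\<^sub>1)" "d\<^sub>2 \<in> hom C V\<^sub>1 (K\<^sub>2 \<otimes> V\<^sub>2)"
    "l\<^sub>1 \<in> hom C (K\<^sub>1 \<otimes> W\<^sub>1) B\<^sub>1" "l\<^sub>2 \<in> hom C (K\<^sub>2 \<otimes> W\<^sub>2) B\<^sub>2"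
  shows "whisker B\<^sub>1 (pairing K\<^sub>2 V\<^sub>2 W\<^sub>2 d\<^sub>2 l\<^sub>2) \<one> \<cdot> whisker \<one> (pairing K\<^sub>1 V\<^sub>1 W\<^sub>1 d\<^sub>1 l\<^sub>1) W\<^sub>2 =
    pairing (K\<^sub>1 \<otimes> K\<^sub>2) V\<^sub>2 (W\<^sub>1 \<otimes> W\<^sub>2) (whisker K\<^sub>1 d\<^sub>2 \<one> \<cdot> d\<^sub>1)
      ((l\<^sub>1 \<boxtimes> l\<^sub>2) \<cdot> whisker K\<^sub>1 (\<c> K\<^sub>2 W\<^sub>1) W\<^sub>2)"
proof -
  note [simp] = assms(1-6) hom_data[OF assms(7)] hom_data[OF assms(8)]
    hom_data[OF assms(9)] hom_data[OF assms(10)]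
  note eqs = symm_natural_whisker(1)[OF assms(1,8,5,6), symmetric]
      whisker_slide[OF unit_obj assms(9) unit_obj assms(8) assms(6)]
      whisker_slide[OF unit_obj assms(9) unit_obj assms(10) assms(4)]
      whisker_slide[OF unit_obj assms(9) assms(2) symm_hom[OF assms(4,6)] unit_obj]
      whisker_slide[OF assms(1) symm_hom[OF assms(2,5)] unit_obj symm_hom[OF assms(4,6)] unit_obj]
  note eqs = eqs [simplified]
  show ?thesis
    by (simp add: pairing_def symm_tensor_right symm_tensor_left tensor_left_last eqs eqs[THEN comp_prefix_eq])
qed

text \<open>
  The mirror situation: \<open>A\<^sub>2\<close> and then \<open>A\<^sub>1\<close> cross one strand \<open>W\<close>.
\<close>

lemma pairing_fuse_left:
  assumes "K\<^sub>1 \<in> obj C" "K\<^sub>2 \<in> obj C" "V\<^sub>1 \<in> obj C" "V\<^sub>2 \<in> obj C" "W \<in> obj C"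
    "d\<^sub>1 \<in> hom C A\<^sub>1 (K\<^sub>1 \<otimes> V\<^sub>1)" "d\<^sub>2 \<in> hom C A\<^sub>2 (K\<^sub>2 \<otimes> V\<^sub>2)"
    "l\<^sub>1 \<in> hom C (K\<^sub>1 \<otimes> B) B'" "l\<^sub>2 \<in> hom C (K\<^sub>2 \<otimes> W) B"
  shows "whisker \<one> (pairing K\<^sub>1 V\<^sub>1 B d\<^sub>1 l\<^sub>1) V\<^sub>2 \<cdot> whisker A\<^sub>1 (pairing K\<^sub>2 V\<^sub>2 W d\<^sub>2 l\<^sub>2) \<one> =
    pairing (K\<^sub>1 \<otimes> K\<^sub>2) (V\<^sub>1 \<otimes> V\<^sub>2) W
      (whisker K\<^sub>1 (\<c> V\<^sub>1 K\<^sub>2) V\<^sub>2 \<cdot> (d\<^sub>1 \<boxtimes> d\<^sub>2)) (l\<^sub>1 \<cdot> whisker K\<^sub>1 l\<^sub>2 \<one>)"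
proof -
  note [simp] = assms(1-5) hom_data[OF assms(6)] hom_data[OF assms(7)]
    hom_data[OF assms(8)] hom_data[OF assms(9)]
  note eqs = symm_natural_whisker(2)[OF assms(1,9,3,4)]
      whisker_slide[OF unit_obj assms(6) unit_obj assms(7) assms(5), symmetric]
      whisker_slide[OF unit_obj assms(6) unit_obj assms(9) assms(4), symmetric]
      whisker_slide[OF unit_obj assms(6) assms(2) symm_hom[OF assms(4,5)] unit_obj, symmetric]
      whisker_slide[OF assms(1) symm_hom[OF assms(3,2)] unit_obj symm_hom[OF assms(4,5)] unit_obj]
  note eqs = eqs [simplified]
  show ?thesis
    by (simp add: pairing_def symm_tensor_right symm_tensor_left tensor_left_last eqs eqs[THEN comp_prefix_eq])
qed

text \<open>
  Part of the target strand may be moved into the strand \<open>K\<close> by letting \<open>V\<close> cross it beforehand.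
\<close>

lemma pairing_absorb:
  assumes "K \<in> obj C" "V \<in> obj C" "X \<in> obj C" "W \<in> obj C"
    "d \<in> hom C A (K \<otimes> V)" "l \<in> hom C (K \<otimes> X \<otimes> W) B"
  shows "pairing K V (X \<otimes> W) d l = pairing (K \<otimes> X) V W (whisker K (\<c> V X) \<one> \<cdot> whisker \<one> d X) l"
proof -
  note [simp] = assms(1-4) hom_data[OF assms(5)] hom_data[OF assms(6)]
  show ?thesis by (simp add: pairing_def symm_tensor_right)
qed

text \<open>
  Both sides permute \<open>A \<otimes> B \<otimes> X \<otimes> Y\<close> to \<open>B \<otimes> Y \<otimes> A \<otimes> X\<close>. This turns axioms written with \<open>\<delta>\<close>
  into axioms for \<open>\<c> V H \<cdot> \<delta>\<close>.
\<close>

lemma symm_shuffle: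
  assumes [simp]: "A \<in> obj C" "B \<in> obj C" "X \<in> obj C" "Y \<in> obj C"
  shows "\<c> (A \<otimes> X) (B \<otimes> Y) \<cdot> whisker A (\<c> B X) Y =
    whisker B (\<c> A Y) X \<cdot> (\<c> A B \<boxtimes> \<c> X Y)"
proof -
  note eqs = symm_symm_whisker[OF assms]
    whisker_slide[OF unit_obj symm_hom[OF assms(1,2)] unit_obj symm_hom[OF assms(3,4)] unit_obj]
  note eqs = eqs [simplified]
  show ?thesis
    by (simp add: symm_tensor_right symm_tensor_left tensor_left_last eqs eqs[THEN comp_prefix_eq])
qed

section \<open>Diagonal actions and codiagonal coactions\<close>

text \<open>
  The diagonal action \<open>h(w \<otimes> w') = \<Sum> h\<^sub>1 w \<otimes> h\<^sub>2 w'\<close> for the coproduct \<open>D\<close>, later applied to the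
  opposite coproduct of \<open>H\<close>. The word action is used loosely: without compatibility of the product
  and the coproduct of \<open>H\<close>, the result need not be a module structure. The same remark applies to
  codiagonal coactions.
\<close>

definition diag_action :: "'o \<Rightarrow> 'm \<Rightarrow> 'o \<Rightarrow> 'o \<Rightarrow> 'm \<Rightarrow> 'm \<Rightarrow> 'm"
  where "diag_action H D W\<^sub>1 W\<^sub>2 l\<^sub>1 l\<^sub>2 =
    (l\<^sub>1 \<boxtimes> l\<^sub>2) \<cdot> whisker H (\<c> H W\<^sub>1) W\<^sub>2 \<cdot> whisker \<one> D (W\<^sub>1 \<otimes> W\<^sub>2)"

definition codiag_coaction :: "'o \<Rightarrow> 'm \<Rightarrow> 'o \<Rightarrow> 'o \<Rightarrow> 'm \<Rightarrow> 'm \<Rightarrow> 'm"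
  where "codiag_coaction H m V\<^sub>1 V\<^sub>2 d\<^sub>1 d\<^sub>2 =
    whisker \<one> m (V\<^sub>1 \<otimes> V\<^sub>2) \<cdot> whisker H (\<c> V\<^sub>1 H) V\<^sub>2 \<cdot> (d\<^sub>1 \<boxtimes> d\<^sub>2)"

lemma diag_action_hom:
  assumes "D \<in> hom C H (H \<otimes> H)" "W\<^sub>1 \<in> obj C" "W\<^sub>2 \<in> obj C"
    "l\<^sub>1 \<in> hom C (H \<otimes> W\<^sub>1) X\<^sub>1" "l\<^sub>2 \<in> hom C (H \<otimes> W\<^sub>2) X\<^sub>2"
  shows "diag_action H D W\<^sub>1 W\<^sub>2 l\<^sub>1 l\<^sub>2 \<in> hom C (H \<otimes> W\<^sub>1 \<otimes> W\<^sub>2) (X\<^sub>1 \<otimes> X\<^sub>2)"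
proof -
  note [simp] = assms(2,3) hom_data[OF assms(1)] hom_data[OF assms(4)] hom_data[OF assms(5)]
  show ?thesis by (rule homI) (simp_all add: diag_action_def)
qed

lemma diag_action_natural:
  assumes "D \<in> hom C H (H \<otimes> H)"
    "f\<^sub>1 \<in> hom C W\<^sub>1 W\<^sub>1'" "l\<^sub>1 \<in> hom C (H \<otimes> W\<^sub>1) W\<^sub>1" "l\<^sub>1' \<in> hom C (H \<otimes> W\<^sub>1') W\<^sub>1'"
    "f\<^sub>2 \<in> hom C W\<^sub>2 W\<^sub>2'" "l\<^sub>2 \<in> hom C (H \<otimes> W\<^sub>2) W\<^sub>2" "l\<^sub>2' \<in> hom C (H \<otimes> W\<^sub>2') W\<^sub>2'"
    "l\<^sub>1' \<cdot> whisker H f\<^sub>1 \<one> = f\<^sub>1 \<cdot> l\<^sub>1" "l\<^sub>2' \<cdot> whisker H f\<^sub>2 \<one> = f\<^sub>2 \<cdot> l\<^sub>2"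
  shows "diag_action H D W\<^sub>1' W\<^sub>2' l\<^sub>1' l\<^sub>2' \<cdot> whisker H (f\<^sub>1 \<boxtimes> f\<^sub>2) \<one> =
    (f\<^sub>1 \<boxtimes> f\<^sub>2) \<cdot> diag_action H D W\<^sub>1 W\<^sub>2 l\<^sub>1 l\<^sub>2"
proof -
  note [simp] = hom_data[OF assms(1)] hom_data[OF assms(2)] hom_data[OF assms(3)]
    hom_data[OF assms(4)] hom_data[OF assms(5)] hom_data[OF assms(6)] hom_data[OF assms(7)]
  note eqs =
    whisker_slide[OF unit_obj assms(1) unit_obj assms(2) hom_data(5)[OF assms(5)], symmetric]
    whisker_slide[OF unit_obj assms(1) hom_data(4)[OF assms(2)] assms(5) unit_obj, symmetric]
    symm_natural_whisker(2)[OF hom_data(4)[OF assms(1)] assms(2) hom_data(4)[OF assms(1)] hom_data(5)[OF assms(5)]]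
    whisker_slide[OF hom_data(4)[OF assms(1)]
      symm_hom[OF hom_data(4)[OF assms(1)] hom_data(4)[OF assms(2)]] unit_obj assms(5) unit_obj, symmetric]
    whisker_slide[OF hom_data(4)[OF assms(1)] assms(2) unit_obj assms(7) unit_obj]
    whisker_slide[OF unit_obj assms(3) unit_obj assms(5) unit_obj]
    arg_cong[OF assms(8), of "\<lambda>x. whisker \<one> x W\<^sub>2'"]
    arg_cong[OF assms(9), of "\<lambda>x. whisker (H \<otimes> W\<^sub>1) x \<one>"]
  note eqs = eqs [simplified]
  show ?thesis
    by (simp add: diag_action_def tensor_left_last eqs eqs[THEN comp_prefix_eq])
qed

text \<open>
  The counit makes \<open>\<one>\<close> a neutral object for the diagonal action. Together with
  \<open>diag_action_natural\<close> this shows that tensoring with a linear unit \<open>\<nu> : \<one> \<rightarrow> V\<close> preserves linearity.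
\<close>

lemma diag_action_counit_left:
  assumes "D \<in> hom C H (H \<otimes> H)" "e \<in> hom C H \<one>" "W \<in> obj C" "l \<in> hom C (H \<otimes> W) X"
    "whisker \<one> e H \<cdot> D = \<i>\<d> H"
  shows "diag_action H D \<one> W e l = l"
proof -
  note [simp] = assms(3) hom_data[OF assms(1)] hom_data[OF assms(2)] hom_data[OF assms(4)]
  note eqs = whisker_slide[OF unit_obj assms(2) unit_obj assms(4) unit_obj, symmetric]
    arg_cong[OF assms(5), of "\<lambda>x. whisker \<one> x W"]
  note eqs = eqs [simplified]
  show ?thesis
    by (simp add: diag_action_def tensor_left_last eqs eqs[THEN comp_prefix_eq])
qed

lemma diag_action_counit_right:
  assumes "D \<in> hom C H (H \<otimes> H)" "e \<in> hom C H \<one>" "W \<in> obj C" "l \<in> hom C (H \<otimes> W) X"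
    "whisker H e \<one> \<cdot> D = \<i>\<d> H"
  shows "diag_action H D W \<one> l e = l"
proof -
  note [simp] = assms(3) hom_data[OF assms(1)] hom_data[OF assms(2)] hom_data[OF assms(4)]
  note eqs = symm_natural_whisker(1)[OF hom_data(4)[OF assms(2)] assms(2,3) unit_obj, symmetric]
    arg_cong[OF assms(5), of "\<lambda>x. whisker \<one> x W"]
  note eqs = eqs [simplified]
  show ?thesis
    by (simp add: diag_action_def tensor_left_last eqs eqs[THEN comp_prefix_eq])
qed

lemma codiag_coaction_hom:
  assumes "m \<in> hom C (H \<otimes> H) H" "V\<^sub>1 \<in> obj C" "V\<^sub>2 \<in> obj C"
    "d\<^sub>1 \<in> hom C X\<^sub>1 (H \<otimes> V\<^sub>1)" "d\<^sub>2 \<in> hom C X\<^sub>2 (H \<otimes> V\<^sub>2)"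
  shows "codiag_coaction H m V\<^sub>1 V\<^sub>2 d\<^sub>1 d\<^sub>2 \<in> hom C (X\<^sub>1 \<otimes> X\<^sub>2) (H \<otimes> V\<^sub>1 \<otimes> V\<^sub>2)"
proof -
  note [simp] = assms(2,3) hom_data[OF assms(1)] hom_data[OF assms(4)] hom_data[OF assms(5)]
  show ?thesis by (rule homI) (simp_all add: codiag_coaction_def)
qed

lemma codiag_coaction_natural:
  assumes "m \<in> hom C (H \<otimes> H) H"
    "f\<^sub>1 \<in> hom C V\<^sub>1 V\<^sub>1'" "d\<^sub>1 \<in> hom C V\<^sub>1 (H \<otimes> V\<^sub>1)" "d\<^sub>1' \<in> hom C V\<^sub>1' (H \<otimes> V\<^sub>1')"
    "f\<^sub>2 \<in> hom C V\<^sub>2 V\<^sub>2'" "d\<^sub>2 \<in> hom C V\<^sub>2 (H \<otimes> V\<^sub>2)" "d\<^sub>2' \<in> hom C V\<^sub>2' (H \<otimes> V\<^sub>2')"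
    "d\<^sub>1' \<cdot> f\<^sub>1 = whisker H f\<^sub>1 \<one> \<cdot> d\<^sub>1" "d\<^sub>2' \<cdot> f\<^sub>2 = whisker H f\<^sub>2 \<one> \<cdot> d\<^sub>2"
  shows "codiag_coaction H m V\<^sub>1' V\<^sub>2' d\<^sub>1' d\<^sub>2' \<cdot> (f\<^sub>1 \<boxtimes> f\<^sub>2) =
    whisker H (f\<^sub>1 \<boxtimes> f\<^sub>2) \<one> \<cdot> codiag_coaction H m V\<^sub>1 V\<^sub>2 d\<^sub>1 d\<^sub>2"
proof -
  have H: "H \<in> obj C" by (rule hom_data(5)[OF assms(1)])
  note [simp] = hom_data[OF assms(1)] hom_data[OF assms(2)] hom_data[OF assms(3)]
    hom_data[OF assms(4)] hom_data[OF assms(5)] hom_data[OF assms(6)] hom_data[OF assms(7)]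
  note eqs =
    whisker_slide[OF unit_obj assms(1) unit_obj assms(2) hom_data(5)[OF assms(5)]]
    whisker_slide[OF unit_obj assms(1) hom_data(4)[OF assms(2)] assms(5) unit_obj]
    symm_natural_whisker(1)[OF H assms(2) H hom_data(5)[OF assms(5)], symmetric]
    whisker_slide[OF H
      symm_hom[OF hom_data(4)[OF assms(2)] H] unit_obj assms(5) unit_obj]
    whisker_slide[OF unit_obj assms(3) H assms(5) unit_obj, symmetric]
    whisker_slide[OF unit_obj assms(2) unit_obj assms(7) unit_obj]
    arg_cong[OF assms(8), of "\<lambda>x. whisker \<one> x (H \<otimes> V\<^sub>2')"]
    arg_cong[OF assms(9), of "\<lambda>x. whisker V\<^sub>1 x \<one>"]
  note eqs = eqs [simplified]
  show ?thesis
    by (simp add: codiag_coaction_def tensor_left_last eqs eqs[THEN comp_prefix_eq])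
qed

lemma codiag_coaction_unit_left:
  assumes "m \<in> hom C (H \<otimes> H) H" "n \<in> hom C \<one> H" "V \<in> obj C" "d \<in> hom C X (H \<otimes> V)"
    "m \<cdot> whisker \<one> n H = \<i>\<d> H"
  shows "codiag_coaction H m \<one> V n d = d"
proof -
  note [simp] = assms(3) hom_data[OF assms(1)] hom_data[OF assms(2)] hom_data[OF assms(4)]
  note eqs = arg_cong[OF assms(5), of "\<lambda>x. whisker \<one> x V"]
  note eqs = eqs [simplified]
  show ?thesis
    by (simp add: codiag_coaction_def tensor_left_last eqs eqs[THEN comp_prefix_eq])
qed

lemma codiag_coaction_unit_right:
  assumes "m \<in> hom C (H \<otimes> H) H" "n \<in> hom C \<one> H" "V \<in> obj C" "d \<in> hom C X (H \<otimes> V)"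
    "m \<cdot> whisker H n \<one> = \<i>\<d> H"
  shows "codiag_coaction H m V \<one> d n = d"
proof -
  note [simp] = assms(3) hom_data[OF assms(1)] hom_data[OF assms(2)] hom_data[OF assms(4)]
  note eqs = symm_natural_whisker(2)[OF hom_data(5)[OF assms(2)] assms(2,3) unit_obj]
    arg_cong[OF assms(5), of "\<lambda>x. whisker \<one> x V"]
  note eqs = eqs [simplified]
  show ?thesis
    by (simp add: codiag_coaction_def tensor_left_first eqs eqs[THEN comp_prefix_eq])
qed

section \<open>Reduction of the Yang-Baxter equation\<close>

text \<open>
  The strand \<open>V\<close> crosses \<open>W\<^sub>1\<close> and \<open>W\<^sub>2\<close> on both sides of the equation, before or after \<open>s\<close> acts on
  them. By fusion and coassociativity the two crossings are the pairing of \<open>d\<close> with the diagonal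
  action, so naturality of the pairing in its right argument carries \<open>s\<close> across.
\<close>

lemma yang_baxter_if_linear:
  assumes "D \<in> hom C H (H \<otimes> H)" "d \<in> hom C V (H \<otimes> V)" "whisker H d \<one> \<cdot> d = whisker \<one> D V \<cdot> d"
    "l\<^sub>1 \<in> hom C (H \<otimes> W\<^sub>1) W\<^sub>1" "l\<^sub>2 \<in> hom C (H \<otimes> W\<^sub>2) W\<^sub>2" "s \<in> hom C (W\<^sub>1 \<otimes> W\<^sub>2) (W\<^sub>2 \<otimes> W\<^sub>1)"
    "diag_action H D W\<^sub>2 W\<^sub>1 l\<^sub>2 l\<^sub>1 \<cdot> whisker H s \<one> = s \<cdot> diag_action H D W\<^sub>1 W\<^sub>2 l\<^sub>1 l\<^sub>2"
  shows "whisker \<one> s V \<cdot> whisker W\<^sub>1 (pairing H V W\<^sub>2 d l\<^sub>2) \<one> \<cdot> whisker \<one> (pairing H V W\<^sub>1 d l\<^sub>1) W\<^sub>2 =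
    whisker W\<^sub>2 (pairing H V W\<^sub>1 d l\<^sub>1) \<one> \<cdot> whisker \<one> (pairing H V W\<^sub>2 d l\<^sub>2) W\<^sub>1 \<cdot> whisker V s \<one>"
proof -
  have [simp]: "H \<in> obj C" "V \<in> obj C" "W\<^sub>1 \<in> obj C" "W\<^sub>2 \<in> obj C"
    using hom_data[OF assms(1)] hom_data[OF assms(2)] hom_data[OF assms(4)] hom_data[OF assms(5)]
    by auto
  have fuse: "whisker W (pairing H V W' d l') \<one> \<cdot> whisker \<one> (pairing H V W d l) W' =
      pairing H V (W \<otimes> W') d (diag_action H D W W' l l')"
    if [simp]: "W \<in> obj C" "W' \<in> obj C"
      and l: "l \<in> hom C (H \<otimes> W) W" "l' \<in> hom C (H \<otimes> W') W'" for W W' l l'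
  proof -
    note [simp] = hom_data[OF l(1)] hom_data[OF l(2)]
    have "(l \<boxtimes> l') \<cdot> whisker H (\<c> H W) W' \<in> hom C ((H \<otimes> H) \<otimes> W \<otimes> W') (W \<otimes> W')"
      by (rule homI) simp_all
    from pairing_balanced[OF _ _ assms(2) this assms(1)]
    show ?thesis
      using pairing_fuse_right[OF _ _ _ _ _ _ assms(2,2) l]
      by (simp add: assms(3) diag_action_def hom_data[OF assms(1)])
  qed
  note E = diag_action_hom[OF assms(1)]
  note [simp] = pairing_hom[OF _ _ _ assms(2,4), THEN hom_data(1)]
    pairing_hom[OF _ _ _ assms(2,4), THEN hom_data(2)]
    pairing_hom[OF _ _ _ assms(2,4), THEN hom_data(3)]
    pairing_hom[OF _ _ _ assms(2,5), THEN hom_data(1)]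
    pairing_hom[OF _ _ _ assms(2,5), THEN hom_data(2)]
    pairing_hom[OF _ _ _ assms(2,5), THEN hom_data(3)]
    hom_data[OF assms(6)]
  have "whisker \<one> s V \<cdot> pairing H V (W\<^sub>1 \<otimes> W\<^sub>2) d (diag_action H D W\<^sub>1 W\<^sub>2 l\<^sub>1 l\<^sub>2) =
      pairing H V (W\<^sub>2 \<otimes> W\<^sub>1) d (diag_action H D W\<^sub>2 W\<^sub>1 l\<^sub>2 l\<^sub>1) \<cdot> whisker V s \<one>"
    using pairing_postcomp_right[OF _ _ _ assms(2) E[OF _ _ assms(4,5)] assms(6)]
      pairing_precomp_right[OF _ _ assms(2) E[OF _ _ assms(5,4)] assms(6)]
    by (simp add: assms(7))
  then show ?thesis
    using fuse[OF _ _ assms(4,5)] fuse[OF _ _ assms(5,4), symmetric] by simp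
qed

text \<open>
  The mirror argument: \<open>V\<^sub>1\<close> and \<open>V\<^sub>2\<close> cross the strand \<open>W\<close>, which by fusion and associativity of
  the action is the pairing of the codiagonal coaction with \<open>l\<close>.
\<close>

lemma yang_baxter_if_colinear:
  assumes "m \<in> hom C (H \<otimes> H) H" "l \<in> hom C (H \<otimes> W) W" "l \<cdot> whisker \<one> m W = l \<cdot> whisker H l \<one>"
    "d\<^sub>1 \<in> hom C V\<^sub>1 (H \<otimes> V\<^sub>1)" "d\<^sub>2 \<in> hom C V\<^sub>2 (H \<otimes> V\<^sub>2)" "s \<in> hom C (V\<^sub>1 \<otimes> V\<^sub>2) (V\<^sub>2 \<otimes> V\<^sub>1)"
    "codiag_coaction H m V\<^sub>2 V\<^sub>1 d\<^sub>2 d\<^sub>1 \<cdot> s = whisker H s \<one> \<cdot> codiag_coaction H m V\<^sub>1 V\<^sub>2 d\<^sub>1 d\<^sub>2"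
  shows "whisker \<one> (pairing H V\<^sub>2 W d\<^sub>2 l) V\<^sub>1 \<cdot> whisker V\<^sub>2 (pairing H V\<^sub>1 W d\<^sub>1 l) \<one> \<cdot> whisker \<one> s W =
    whisker W s \<one> \<cdot> whisker \<one> (pairing H V\<^sub>1 W d\<^sub>1 l) V\<^sub>2 \<cdot> whisker V\<^sub>1 (pairing H V\<^sub>2 W d\<^sub>2 l) \<one>"
proof -
  have [simp]: "H \<in> obj C" "W \<in> obj C" "V\<^sub>1 \<in> obj C" "V\<^sub>2 \<in> obj C"
    using hom_data[OF assms(1)] hom_data[OF assms(2)] hom_data[OF assms(4)] hom_data[OF assms(5)]
    by auto
  have fuse: "whisker \<one> (pairing H V W d l) V' \<cdot> whisker V (pairing H V' W d' l) \<one> =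
      pairing H (V \<otimes> V') W (codiag_coaction H m V V' d d') l"
    if [simp]: "V \<in> obj C" "V' \<in> obj C"
      and d: "d \<in> hom C V (H \<otimes> V)" "d' \<in> hom C V' (H \<otimes> V')" for V V' d d'
  proof -
    note [simp] = hom_data[OF d(1)] hom_data[OF d(2)]
    have "whisker H (\<c> V H) V' \<cdot> (d \<boxtimes> d') \<in> hom C (V \<otimes> V') ((H \<otimes> H) \<otimes> V \<otimes> V')"
      by (rule homI) simp_all
    from pairing_balanced[OF _ _ this assms(2,1)]
    show ?thesis
      using pairing_fuse_left[OF _ _ _ _ _ d assms(2,2)]
      by (simp add: assms(3) codiag_coaction_def hom_data[OF assms(1)])
  qed
  note D = codiag_coaction_hom[OF assms(1)]
  note [simp] = pairing_hom[OF _ _ _ assms(4,2), THEN hom_data(1)]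
    pairing_hom[OF _ _ _ assms(4,2), THEN hom_data(2)]
    pairing_hom[OF _ _ _ assms(4,2), THEN hom_data(3)]
    pairing_hom[OF _ _ _ assms(5,2), THEN hom_data(1)]
    pairing_hom[OF _ _ _ assms(5,2), THEN hom_data(2)]
    pairing_hom[OF _ _ _ assms(5,2), THEN hom_data(3)]
    hom_data[OF assms(6)]
  have "pairing H (V\<^sub>2 \<otimes> V\<^sub>1) W (codiag_coaction H m V\<^sub>2 V\<^sub>1 d\<^sub>2 d\<^sub>1) l \<cdot> whisker \<one> s W =
      whisker W s \<one> \<cdot> pairing H (V\<^sub>1 \<otimes> V\<^sub>2) W (codiag_coaction H m V\<^sub>1 V\<^sub>2 d\<^sub>1 d\<^sub>2) l"
    using pairing_precomp_left[OF _ _ _ D[OF _ _ assms(5,4)] assms(2,6)]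
      pairing_postcomp_left[OF _ _ D[OF _ _ assms(4,5)] assms(2,6)]
    by (simp add: assms(7))
  then show ?thesis
    using fuse[OF _ _ assms(5,4), THEN comp_prefix_eq, of "whisker \<one> s W"] fuse[OF _ _ assms(4,5)] by simp
qed

section \<open>Linearity and colinearity of the braiding\<close>

text \<open>
  On both sides the element of \<open>W\<close> is acted upon twice. Associativity of that action combines the two,
  and each side becomes the pairing of \<open>l\<^sub>W\<close> with an arrow \<open>H \<otimes> V \<rightarrow> H \<otimes> V\<close>. With
  \<open>D(h) = h\<^sub>1 \<otimes> h\<^sub>2\<close> and \<open>d(v) = v\<^sub>1 \<otimes> v\<^sub>0\<close>, the arrow for the right-hand side is
  \<open>h \<otimes> v \<mapsto> (h\<^sub>1 v)\<^sub>1 h\<^sub>2 \<otimes> (h\<^sub>1 v)\<^sub>0\<close> and the one for the left-hand side is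
  \<open>h \<otimes> v \<mapsto> h\<^sub>1 v\<^sub>1 \<otimes> h\<^sub>2 v\<^sub>0\<close>. Their equality is the Yetter-Drinfel'd condition \<open>yd\<close>.
\<close>

lemma pairing_linear_if_yd:
  assumes "D \<in> hom C H (H \<otimes> H)" "m \<in> hom C (H \<otimes> H) H" "d \<in> hom C V (H \<otimes> V)"
    "l\<^sub>V \<in> hom C (H \<otimes> V) V" "l\<^sub>W \<in> hom C (H \<otimes> W) W"
    "l\<^sub>W \<cdot> whisker \<one> m W = l\<^sub>W \<cdot> whisker H l\<^sub>W \<one>"
    and yd: "whisker \<one> m V \<cdot> whisker H (\<c> V H) \<one> \<cdot> whisker \<one> d H \<cdot> whisker \<one> l\<^sub>V H \<cdot>
        whisker H (\<c> H V) \<one> \<cdot> whisker \<one> D V =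
      (m \<boxtimes> l\<^sub>V) \<cdot> whisker H (\<c> H H) V \<cdot> (D \<boxtimes> d)"
  shows "diag_action H D W V l\<^sub>W l\<^sub>V \<cdot> whisker H (pairing H V W d l\<^sub>W) \<one> =
    pairing H V W d l\<^sub>W \<cdot> diag_action H D V W l\<^sub>V l\<^sub>W"
proof -
  have [simp]: "H \<in> obj C" "V \<in> obj C" "W \<in> obj C"
    using hom_data[OF assms(1)] hom_data[OF assms(4)] hom_data[OF assms(5)] by auto
  note [simp] = hom_data[OF assms(1)] hom_data[OF assms(2)] hom_data[OF assms(3)]
    hom_data[OF assms(4)] hom_data[OF assms(5)]
  let ?P = "pairing H V W d l\<^sub>W"
  let ?Q = "pairing H H W (\<i>\<d> (H \<otimes> H)) l\<^sub>W"
  have P: "?P \<in> hom C (V \<otimes> W) (W \<otimes> V)"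
    by (rule pairing_hom) (simp_all add: assms)
  have Q: "?Q \<in> hom C ((H \<otimes> H) \<otimes> W) (W \<otimes> H)"
    by (rule pairing_hom) (simp_all add: assms ident_hom)
  note [simp] = hom_data[OF P] hom_data[OF Q]
  let ?a = "whisker H (\<c> V H) \<one> \<cdot> whisker \<one> d H"
  let ?a' = "whisker \<one> l\<^sub>V H \<cdot> whisker H (\<c> H V) \<one> \<cdot> whisker \<one> D V"
  let ?b = "whisker H (\<c> H H) V \<cdot> whisker (H \<otimes> H) d \<one>"
  have a: "?a \<in> hom C (V \<otimes> H) ((H \<otimes> H) \<otimes> V)" "?a' \<in> hom C (H \<otimes> V) (V \<otimes> H)"
    "whisker \<one> m V \<cdot> ?a \<in> hom C (V \<otimes> H) (H \<otimes> V)"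
    by (rule homI; simp)+
  have b: "?b \<in> hom C (H \<otimes> H \<otimes> V) ((H \<otimes> H) \<otimes> H \<otimes> V)"
    "whisker \<one> m (H \<otimes> V) \<cdot> ?b \<in> hom C (H \<otimes> H \<otimes> V) (H \<otimes> H \<otimes> V)"
    "whisker H l\<^sub>V \<one> \<cdot> whisker \<one> m (H \<otimes> V) \<cdot> ?b \<in> hom C (H \<otimes> H \<otimes> V) (H \<otimes> V)"
    "whisker \<one> D V \<in> hom C (H \<otimes> V) (H \<otimes> H \<otimes> V)"
    by (rule homI; simp)+
  \<comment> \<open>The right-hand side: the element of \<open>H\<close> that acts on \<open>W\<close> first is
    absorbed into the strand of emitted elements, where the product of \<open>H\<close> combines the two.\<close>
  have "?P \<cdot> whisker V l\<^sub>W \<one> = pairing H V (H \<otimes> W) d (l\<^sub>W \<cdot> whisker \<one> m W)"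
    using pairing_precomp_right[OF _ _ assms(3,5,5)] by (simp add: assms(6))
  also have "\<dots> = pairing (H \<otimes> H) V W ?a (l\<^sub>W \<cdot> whisker \<one> m W)"
    by (rule pairing_absorb[OF _ _ _ _ assms(3), where B = W]) (simp_all add: homI)
  also have "\<dots> = pairing H V W (whisker \<one> m V \<cdot> ?a) l\<^sub>W"
    by (rule pairing_balanced[OF _ _ a(1) assms(5,2), symmetric]) simp_all
  finally have "?P \<cdot> whisker V l\<^sub>W \<one> = pairing H V W (whisker \<one> m V \<cdot> ?a) l\<^sub>W" .
  then have "?P \<cdot> whisker V l\<^sub>W \<one> \<cdot> whisker \<one> ?a' W =
      pairing H V W (whisker \<one> m V \<cdot> ?a) l\<^sub>W \<cdot> whisker \<one> ?a' W"
    by (rule comp_prefix_eq) simp_all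
  also have "\<dots> = pairing H V W ((whisker \<one> m V \<cdot> ?a) \<cdot> ?a') l\<^sub>W"
    by (rule pairing_precomp_left[OF _ _ _ a(3) assms(5) a(2), symmetric]) simp_all
  finally have R: "?P \<cdot> diag_action H D V W l\<^sub>V l\<^sub>W =
      pairing H V W ((whisker \<one> m V \<cdot> ?a) \<cdot> ?a') l\<^sub>W"
    by (simp add: diag_action_def tensor_left_first)

  \<comment> \<open>The left-hand side: \<open>?Q\<close> is \<open>h \<otimes> h' \<otimes> w \<mapsto> h w \<otimes> h'\<close>, the part of the diagonal action that acts on
    \<open>W\<close>, written as a pairing so that it fuses with \<open>?P\<close>.\<close>
  have "whisker \<one> ?Q V \<cdot> whisker (H \<otimes> H) ?P \<one> =
      pairing (H \<otimes> H) (H \<otimes> V) W ?b (l\<^sub>W \<cdot> whisker \<one> m W)"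
    using pairing_fuse_left[OF _ _ _ _ _ ident_hom assms(3,5,5)] by (simp add: assms(6))
  also have "\<dots> = pairing H (H \<otimes> V) W (whisker \<one> m (H \<otimes> V) \<cdot> ?b) l\<^sub>W"
    by (rule pairing_balanced[OF _ _ b(1) assms(5,2), symmetric]) simp_all
  finally have "whisker W l\<^sub>V \<one> \<cdot> whisker \<one> ?Q V \<cdot> whisker (H \<otimes> H) ?P \<one> =
      pairing H V W (whisker H l\<^sub>V \<one> \<cdot> whisker \<one> m (H \<otimes> V) \<cdot> ?b) l\<^sub>W"
    using pairing_postcomp_left[OF _ _ b(2) assms(5,4)] by simp
  then have "(whisker W l\<^sub>V \<one> \<cdot> whisker \<one> ?Q V \<cdot> whisker (H \<otimes> H) ?P \<one>) \<cdot> whisker \<one> D (V \<otimes> W) =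
      pairing H V W ((whisker H l\<^sub>V \<one> \<cdot> whisker \<one> m (H \<otimes> V) \<cdot> ?b) \<cdot> whisker \<one> D V) l\<^sub>W"
    using pairing_precomp_left[OF _ _ _ b(3) assms(5) b(4)] by simp
  then have L: "diag_action H D W V l\<^sub>W l\<^sub>V \<cdot> whisker H ?P \<one> =
      pairing H V W ((whisker H l\<^sub>V \<one> \<cdot> whisker \<one> m (H \<otimes> V) \<cdot> ?b) \<cdot> whisker \<one> D V) l\<^sub>W"
    using whisker_slide[OF unit_obj assms(1) unit_obj P unit_obj]
    by (simp add: diag_action_def tensor_left_first pairing_def[of H H W "\<i>\<d> (H \<otimes> H)"])

  have "(whisker \<one> m V \<cdot> ?a) \<cdot> ?a' =
      (whisker H l\<^sub>V \<one> \<cdot> whisker \<one> m (H \<otimes> V) \<cdot> ?b) \<cdot> whisker \<one> D V"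
    using yd by (simp add: tensor_left_first)
  then show ?thesis unfolding L R by simp
qed

text \<open>
  The action is moved past the crossing; on the way, \<open>V\<close> crosses \<open>H\<close> and \<open>\<delta>\<close> becomes \<open>\<c> V H \<cdot> \<delta>\<close>.
\<close>

lemma sigma_eq_pairing:
  assumes "\<delta> \<in> hom C V (V \<otimes> H)" "l \<in> hom C (H \<otimes> W) W" "H \<in> obj C" "W \<in> obj C"
  shows "\<c> V W \<cdot> (\<i>\<d> V \<boxtimes> l) \<cdot> (\<delta> \<boxtimes> \<i>\<d> W) = pairing H V W (\<c> V H \<cdot> \<delta>) l"
proof -
  note [simp] = assms(3,4) hom_data[OF assms(1)] hom_data[OF assms(2)]
  note eqs = symm_natural_whisker(2)[OF unit_obj assms(2) hom_data(4)[OF assms(1)] unit_obj]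
  note eqs = eqs [simplified]
  show ?thesis by (simp add: pairing_def eqs eqs[THEN comp_prefix_eq] symm_tensor_right)
qed

text \<open>
  For \<open>s = \<nu> \<otimes> \<mu>\<close> both sides are \<open>a \<otimes> b \<otimes> c \<mapsto> 1 \<otimes> 1 \<otimes> abc\<close>, for \<open>s = \<mu> \<otimes> \<nu>\<close> both are
  \<open>a \<otimes> b \<otimes> c \<mapsto> abc \<otimes> 1 \<otimes> 1\<close>.
\<close>

lemma yang_baxter_algebra:
  assumes "unital_algebra C V \<mu> \<nu>" "s = \<nu> \<boxtimes> \<mu> \<or> s = \<mu> \<boxtimes> \<nu>"
  shows "whisker \<one> s V \<cdot> whisker V s \<one> \<cdot> whisker \<one> s V = whisker V s \<one> \<cdot> whisker \<one> s V \<cdot> whisker V s \<one>"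
proof -
  have V [simp]: "V \<in> obj C" and \<mu>: "\<mu> \<in> hom C (V \<otimes> V) V" and \<nu>: "\<nu> \<in> hom C \<one> V"
    using assms(1) by (auto simp: unital_algebra_def)
  note [simp] = hom_data[OF \<mu>] hom_data[OF \<nu>]
  have alg: "\<mu> \<cdot> whisker \<one> \<mu> V = \<mu> \<cdot> whisker V \<mu> \<one>" "\<mu> \<cdot> whisker \<one> \<nu> V = \<i>\<d> V"
    "\<mu> \<cdot> whisker V \<nu> \<one> = \<i>\<d> V"
    using assms(1) by (auto simp: unital_algebra_def)
  show ?thesis
    using assms(2)
  proof
    assume s: "s = \<nu> \<boxtimes> \<mu>"
    note eqs = alg(1) arg_cong[OF alg(2), of "\<lambda>x. whisker \<one> x V"]
      arg_cong[OF alg(3), of "\<lambda>x. whisker \<one> x V"]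
      whisker_slide[OF unit_obj \<nu> unit_obj \<mu> unit_obj]
      whisker_slide[OF unit_obj \<nu> unit_obj \<nu> V]
    note eqs = eqs [simplified]
    show ?thesis by (simp add: s tensor_left_last eqs eqs[THEN comp_prefix_eq])
  next
    assume s: "s = \<mu> \<boxtimes> \<nu>"
    note eqs = alg(1) arg_cong[OF alg(2), of "\<lambda>x. whisker V x \<one>"]
      whisker_slide[OF unit_obj \<mu> unit_obj \<nu> unit_obj, symmetric]
      whisker_slide[OF V \<nu> unit_obj \<nu> unit_obj]
    note eqs = eqs [simplified]
    show ?thesis by (simp add: s tensor_left_first eqs eqs[THEN comp_prefix_eq])
  qed
qed

text \<open>
  The product \<open>\<mu>\<close> is linear from the diagonal action on \<open>V \<otimes> V\<close>, and the unit \<open>\<nu>\<close> from the trivial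
  action \<open>\<epsilon>\<close> on \<open>\<one>\<close>. So their tensor product is linear from \<open>\<one> \<otimes> V \<otimes> V\<close> or \<open>V \<otimes> V \<otimes> \<one>\<close>, both equal to \<open>V \<otimes> V\<close>, where the
  counit law identifies the diagonal action of \<open>\<epsilon>\<close> and the action on \<open>V \<otimes> V\<close> with the latter.
\<close>

lemma module_algebra_linear:
  assumes "counital_coalgebra C H \<Delta> \<epsilon>" "module_algebra C H \<mu>H \<nu>H \<Delta> \<epsilon> V \<mu> \<nu> l"
    "s = \<nu> \<boxtimes> \<mu> \<or> s = \<mu> \<boxtimes> \<nu>"
  shows "diag_action H (\<c> H H \<cdot> \<Delta>) V V l l \<cdot> whisker H s \<one> =
    s \<cdot> diag_action H (\<c> H H \<cdot> \<Delta>) V V l l"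
proof -
  have H [simp]: "H \<in> obj C" and \<Delta>: "\<Delta> \<in> hom C H (H \<otimes> H)" and \<epsilon>: "\<epsilon> \<in> hom C H \<one>"
    using assms(1) by (auto simp: counital_coalgebra_def)
  have V [simp]: "V \<in> obj C" and \<mu>: "\<mu> \<in> hom C (V \<otimes> V) V" and \<nu>: "\<nu> \<in> hom C \<one> V"
    and l: "l \<in> hom C (H \<otimes> V) V"
    using assms(2) by (auto simp: module_algebra_def unital_algebra_def left_module_def)
  note [simp] = hom_data[OF \<Delta>] hom_data[OF \<epsilon>] hom_data[OF \<mu>] hom_data[OF \<nu>] hom_data[OF l]
  let ?D = "\<c> H H \<cdot> \<Delta>" and ?E = "diag_action H (\<c> H H \<cdot> \<Delta>) V V l l"
  have D: "?D \<in> hom C H (H \<otimes> H)" by (rule homI) simp_all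
  have E: "?E \<in> hom C (H \<otimes> V \<otimes> V) (V \<otimes> V)" by (rule diag_action_hom) (simp_all add: D l)
  have \<mu>_lin: "l \<cdot> whisker H \<mu> \<one> = \<mu> \<cdot> ?E" and \<nu>_lin: "l \<cdot> whisker H \<nu> \<one> = \<nu> \<cdot> \<epsilon>"
    using assms(2) by (simp_all add: module_algebra_def diag_action_def tensor_left_first)
  have counit: "whisker \<one> \<epsilon> H \<cdot> \<Delta> = \<i>\<d> H" "whisker H \<epsilon> \<one> \<cdot> \<Delta> = \<i>\<d> H"
    using assms(1) by (auto simp: counital_coalgebra_def)
  note nat = symm_natural_whisker[OF unit_obj \<epsilon> H unit_obj, symmetric]
  note nat = nat[simplified]
  have op_counit: "whisker \<one> \<epsilon> H \<cdot> ?D = \<i>\<d> H" "whisker H \<epsilon> \<one> \<cdot> ?D = \<i>\<d> H"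
    by (simp_all add: nat[THEN comp_prefix_eq] counit)
  have \<epsilon>': "\<epsilon> \<in> hom C (H \<otimes> \<one>) \<one>" using \<epsilon> by simp
  show ?thesis
    using assms(3)
  proof
    assume s: "s = \<nu> \<boxtimes> \<mu>"
    show ?thesis
      using diag_action_natural[OF D \<nu> \<epsilon>' l \<mu> E l \<nu>_lin \<mu>_lin]
      unfolding s diag_action_counit_left[OF D \<epsilon> tensor_obj[OF V V] E op_counit(1)] .
  next
    assume s: "s = \<mu> \<boxtimes> \<nu>"
    show ?thesis
      using diag_action_natural[OF D \<mu> E l \<nu> \<epsilon>' l \<mu>_lin \<nu>_lin]
      unfolding s diag_action_counit_right[OF D \<epsilon> tensor_obj[OF V V] E op_counit(2)] .
  qed
qed

text \<open>
  Dual to \<open>module_algebra_linear\<close>, with \<open>\<nu>H\<close> as the trivial coaction on \<open>\<one>\<close>. The comodule axioms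
  are first rewritten from \<open>\<delta>\<close> to \<open>\<c> V H \<cdot> \<delta>\<close>.
\<close>

lemma comodule_algebra_colinear:
  assumes "unital_algebra C H \<mu>H \<nu>H" "comodule_algebra C H \<mu>H \<nu>H \<Delta> \<epsilon> V \<mu> \<nu> \<delta>"
    "s = \<nu> \<boxtimes> \<mu> \<or> s = \<mu> \<boxtimes> \<nu>"
  shows "codiag_coaction H \<mu>H V V (\<c> V H \<cdot> \<delta>) (\<c> V H \<cdot> \<delta>) \<cdot> s =
    whisker H s \<one> \<cdot> codiag_coaction H \<mu>H V V (\<c> V H \<cdot> \<delta>) (\<c> V H \<cdot> \<delta>)"
proof -
  have H [simp]: "H \<in> obj C" and \<mu>H: "\<mu>H \<in> hom C (H \<otimes> H) H" and \<nu>H: "\<nu>H \<in> hom C \<one> H"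
    using assms(1) by (auto simp: unital_algebra_def)
  have V [simp]: "V \<in> obj C" and \<mu>: "\<mu> \<in> hom C (V \<otimes> V) V" and \<nu>: "\<nu> \<in> hom C \<one> V"
    and \<delta>: "\<delta> \<in> hom C V (V \<otimes> H)"
    using assms(2) by (auto simp: comodule_algebra_def unital_algebra_def right_comodule_def)
  note [simp] = hom_data[OF \<mu>H] hom_data[OF \<nu>H] hom_data[OF \<mu>] hom_data[OF \<nu>] hom_data[OF \<delta>]
  let ?d = "\<c> V H \<cdot> \<delta>" and ?E = "codiag_coaction H \<mu>H V V (\<c> V H \<cdot> \<delta>) (\<c> V H \<cdot> \<delta>)"
  have d: "?d \<in> hom C V (H \<otimes> V)" by (rule homI) simp_all
  have E: "?E \<in> hom C (V \<otimes> V) (H \<otimes> V \<otimes> V)" by (rule codiag_coaction_hom) (simp_all add: d \<mu>H)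
  have "?d \<cdot> \<mu> = \<c> V H \<cdot> (\<mu> \<boxtimes> \<mu>H) \<cdot> whisker V (\<c> H V) H \<cdot> (\<delta> \<boxtimes> \<delta>)"
    using assms(2) by (simp add: comodule_algebra_def)
  also have "\<dots> = (\<mu>H \<boxtimes> \<mu>) \<cdot> (\<c> (V \<otimes> V) (H \<otimes> H) \<cdot> whisker V (\<c> H V) H) \<cdot> (\<delta> \<boxtimes> \<delta>)"
    using symm_natural[OF \<mu> \<mu>H, THEN comp_prefix_eq, of "whisker V (\<c> H V) H \<cdot> (\<delta> \<boxtimes> \<delta>)"] by simp
  also have "\<dots> = (\<mu>H \<boxtimes> \<mu>) \<cdot> whisker H (\<c> V H) V \<cdot> (\<c> V H \<boxtimes> \<c> V H) \<cdot> (\<delta> \<boxtimes> \<delta>)"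
    unfolding symm_shuffle[OF V H V H] by simp
  also have "(\<c> V H \<boxtimes> \<c> V H) \<cdot> (\<delta> \<boxtimes> \<delta>) = ?d \<boxtimes> ?d"
    by (rule interchange_arr[symmetric]) simp_all
  finally have \<mu>_col: "?d \<cdot> \<mu> = whisker H \<mu> \<one> \<cdot> ?E"
    by (simp add: codiag_coaction_def tensor_left_first[of \<mu>H \<mu>])
  have "?d \<cdot> \<nu> = \<c> V H \<cdot> (\<nu> \<boxtimes> \<nu>H)"
    using assms(2) by (simp add: comodule_algebra_def)
  also have "\<dots> = whisker H \<nu> \<one> \<cdot> \<nu>H"
    using symm_natural[OF \<nu> \<nu>H] by (simp add: tensor_left_first[of \<nu>H \<nu>])
  finally have \<nu>_col: "?d \<cdot> \<nu> = whisker H \<nu> \<one> \<cdot> \<nu>H" .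
  have unit: "\<mu>H \<cdot> whisker \<one> \<nu>H H = \<i>\<d> H" "\<mu>H \<cdot> whisker H \<nu>H \<one> = \<i>\<d> H"
    using assms(1) by (auto simp: unital_algebra_def)
  have \<nu>H': "\<nu>H \<in> hom C \<one> (H \<otimes> \<one>)" using \<nu>H by simp
  show ?thesis
    using assms(3)
  proof
    assume s: "s = \<nu> \<boxtimes> \<mu>"
    show ?thesis
      using codiag_coaction_natural[OF \<mu>H \<nu> \<nu>H' d \<mu> E d \<nu>_col \<mu>_col]
      unfolding s codiag_coaction_unit_left[OF \<mu>H \<nu>H tensor_obj[OF V V] E unit(1)] .
  next
    assume s: "s = \<mu> \<boxtimes> \<nu>"
    show ?thesis
      using codiag_coaction_natural[OF \<mu>H \<mu> E d \<nu> \<nu>H' d \<mu>_col \<nu>_col]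
      unfolding s codiag_coaction_unit_right[OF \<mu>H \<nu>H tensor_obj[OF V V] E unit(2)] .
  qed
qed

text \<open>
  Writing the coaction on the left reverses the order of the emitted elements:
  \<open>v\<^sub>0 \<otimes> v\<^sub>1 \<otimes> v\<^sub>2\<close> becomes \<open>v\<^sub>2 \<otimes> v\<^sub>1 \<otimes> v\<^sub>0\<close>. This is why the opposite coproduct enters.
\<close>

lemma comodule_op_coassoc:
  assumes "\<Delta> \<in> hom C H (H \<otimes> H)" "right_comodule C H \<Delta> \<epsilon> V \<delta>"
  shows "whisker H (\<c> V H \<cdot> \<delta>) \<one> \<cdot> \<c> V H \<cdot> \<delta> = whisker \<one> (\<c> H H \<cdot> \<Delta>) V \<cdot> \<c> V H \<cdot> \<delta>"
proof -
  note H [simp] = hom_data(4)[OF assms(1)]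
  have V [simp]: "V \<in> obj C" and \<delta>: "\<delta> \<in> hom C V (V \<otimes> H)"
    using assms(2) by (auto simp: right_comodule_def)
  note [simp] = hom_data[OF assms(1)] hom_data[OF \<delta>]
  have D: "\<c> H H \<cdot> \<Delta> \<in> hom C H (H \<otimes> H)" by (rule homI) simp_all
  have coassoc: "whisker \<one> \<delta> H \<cdot> \<delta> = whisker V \<Delta> \<one> \<cdot> \<delta>"
    using assms(2) by (simp add: right_comodule_def)
  have "whisker H (\<c> V H \<cdot> \<delta>) \<one> \<cdot> \<c> V H \<cdot> \<delta> =
      whisker H (\<c> V H) \<one> \<cdot> (whisker H \<delta> \<one> \<cdot> \<c> V H) \<cdot> \<delta>"
    by simp
  also have "whisker H \<delta> \<one> \<cdot> \<c> V H = \<c> (V \<otimes> H) H \<cdot> whisker \<one> \<delta> H"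
    using symm_natural_whisker(1)[OF unit_obj \<delta> H unit_obj] by simp
  also have "whisker H (\<c> V H) \<one> \<cdot> (\<c> (V \<otimes> H) H \<cdot> whisker \<one> \<delta> H) \<cdot> \<delta> =
      \<c> V (H \<otimes> H) \<cdot> whisker V (\<c> H H \<cdot> \<Delta>) \<one> \<cdot> \<delta>"
    by (simp add: symm_tensor_left symm_tensor_right coassoc)
  also have "\<dots> = whisker \<one> (\<c> H H \<cdot> \<Delta>) V \<cdot> \<c> V H \<cdot> \<delta>"
    using symm_natural_whisker(2)[OF unit_obj D V unit_obj, THEN comp_prefix_eq, of \<delta>] by simp
  finally show ?thesis .
qed

text \<open>
  The Yetter-Drinfel'd condition composed with \<open>\<c> V H\<close>, in the form that \<open>pairing_linear_if_yd\<close>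
  requires.
\<close>

lemma yd_structure_op:
  assumes "\<Delta> \<in> hom C H (H \<otimes> H)" "\<mu>H \<in> hom C (H \<otimes> H) H"
    "yd_structure C H \<mu>H \<nu>H \<Delta> \<epsilon> V l \<delta>"
  shows "whisker \<one> \<mu>H V \<cdot> whisker H (\<c> V H) \<one> \<cdot> whisker \<one> (\<c> V H \<cdot> \<delta>) H \<cdot> whisker \<one> l H \<cdot>
      whisker H (\<c> H V) \<one> \<cdot> whisker \<one> (\<c> H H \<cdot> \<Delta>) V =
    (\<mu>H \<boxtimes> l) \<cdot> whisker H (\<c> H H) V \<cdot> ((\<c> H H \<cdot> \<Delta>) \<boxtimes> (\<c> V H \<cdot> \<delta>))"
proof -
  note H [simp] = hom_data(4)[OF assms(1)]
  have V [simp]: "V \<in> obj C" and \<delta>: "\<delta> \<in> hom C V (V \<otimes> H)" and l: "l \<in> hom C (H \<otimes> V) V"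
    using assms(3) by (auto simp: yd_structure_def right_comodule_def left_module_def)
  note [simp] = hom_data[OF assms(1)] hom_data[OF assms(2)] hom_data[OF \<delta>] hom_data[OF l]
  note eqs = symm_natural_whisker(2)[OF unit_obj assms(2) V unit_obj]
    symm_natural_whisker(2)[OF unit_obj l H unit_obj]
  note eqs = eqs [simplified]
  have "whisker \<one> \<mu>H V \<cdot> whisker H (\<c> V H) \<one> \<cdot> whisker \<one> (\<c> V H \<cdot> \<delta>) H \<cdot> whisker \<one> l H \<cdot>
      whisker H (\<c> H V) \<one> \<cdot> whisker \<one> (\<c> H H \<cdot> \<Delta>) V =
      \<c> V H \<cdot> whisker V \<mu>H \<one> \<cdot> whisker \<one> \<delta> H \<cdot> \<c> H V \<cdot> whisker H l \<one> \<cdot> whisker \<one> \<Delta> V"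
    by (simp add: eqs eqs[THEN comp_prefix_eq] symm_tensor_right)
  also have "\<dots> = \<c> V H \<cdot> (l \<boxtimes> \<mu>H) \<cdot> whisker H (\<c> H V) H \<cdot> (\<Delta> \<boxtimes> \<delta>)"
    using assms(3) by (simp add: yd_structure_def)
  also have "\<dots> = (\<mu>H \<boxtimes> l) \<cdot> (\<c> (H \<otimes> V) (H \<otimes> H) \<cdot> whisker H (\<c> H V) H) \<cdot> (\<Delta> \<boxtimes> \<delta>)"
    using symm_natural[OF l assms(2), THEN comp_prefix_eq, of "whisker H (\<c> H V) H \<cdot> (\<Delta> \<boxtimes> \<delta>)"] by simp
  also have "\<dots> = (\<mu>H \<boxtimes> l) \<cdot> whisker H (\<c> H H) V \<cdot> (\<c> H H \<boxtimes> \<c> V H) \<cdot> (\<Delta> \<boxtimes> \<delta>)"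
    unfolding symm_shuffle[OF H H V H] by simp
  also have "(\<c> H H \<boxtimes> \<c> V H) \<cdot> (\<Delta> \<boxtimes> \<delta>) = (\<c> H H \<cdot> \<Delta>) \<boxtimes> (\<c> V H \<cdot> \<delta>)"
    by (rule interchange_arr[symmetric]) simp_all
  finally show ?thesis .
qed

section \<open>Invertibility over a Hopf algebra\<close>

text \<open>
  The two factors are \<open>v \<otimes> w \<mapsto> v\<^sub>0 \<otimes> x(v\<^sub>1) w\<close> and the same with \<open>y\<close>, so their composite is
  \<open>v \<otimes> w \<mapsto> v\<^sub>0 \<otimes> x(v\<^sub>1) y(v\<^sub>2) w\<close>. If the convolution product of \<open>x\<close> and \<open>y\<close> is trivial, this is the
  identity. The antipode and the identity may be taken in either order.
\<close>

lemma twisted_action_cancel: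
  assumes "right_comodule C H \<Delta> \<epsilon> V \<delta>" "left_module C H \<mu>H \<nu>H W l"
    "\<Delta> \<in> hom C H (H \<otimes> H)" "\<epsilon> \<in> hom C H \<one>" "\<mu>H \<in> hom C (H \<otimes> H) H" "\<nu>H \<in> hom C \<one> H"
    "x \<in> hom C H H" "y \<in> hom C H H" "\<mu>H \<cdot> (x \<boxtimes> y) \<cdot> \<Delta> = \<nu>H \<cdot> \<epsilon>"
  shows "(whisker V (l \<cdot> whisker \<one> x W) \<one> \<cdot> whisker \<one> \<delta> W) \<cdot>
    (whisker V (l \<cdot> whisker \<one> y W) \<one> \<cdot> whisker \<one> \<delta> W) = \<i>\<d> (V \<otimes> W)"
proof -
  have V [simp]: "V \<in> obj C" and \<delta>: "\<delta> \<in> hom C V (V \<otimes> H)"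
    and W [simp]: "W \<in> obj C" and l: "l \<in> hom C (H \<otimes> W) W"
    using assms(1,2) by (auto simp: right_comodule_def left_module_def)
  note H [simp] = hom_data(4)[OF assms(3)]
  note [simp] = hom_data[OF \<delta>] hom_data[OF l] hom_data[OF assms(3)] hom_data[OF assms(4)]
    hom_data[OF assms(5)] hom_data[OF assms(6)] hom_data[OF assms(7)] hom_data[OF assms(8)]
  have coassoc: "whisker \<one> \<delta> H \<cdot> \<delta> = whisker V \<Delta> \<one> \<cdot> \<delta>" and counit: "whisker V \<epsilon> \<one> \<cdot> \<delta> = \<i>\<d> V"
    using assms(1) by (auto simp: right_comodule_def)
  have act: "l \<cdot> whisker H l \<one> = l \<cdot> whisker \<one> \<mu>H W" and unit: "l \<cdot> whisker \<one> \<nu>H W = \<i>\<d> W"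
    using assms(2) by (auto simp: left_module_def)
  note eqs = whisker_slide[OF unit_obj \<delta> unit_obj l unit_obj, symmetric]
    whisker_slide[OF unit_obj \<delta> unit_obj assms(8) W, symmetric]
    whisker_slide[OF V assms(7) unit_obj l unit_obj, symmetric]
    arg_cong[OF act, of "\<lambda>x. whisker V x \<one>"] arg_cong[OF coassoc, of "\<lambda>x. whisker \<one> x W"]
  note eqs = eqs [simplified]
  have "(whisker V (l \<cdot> whisker \<one> x W) \<one> \<cdot> whisker \<one> \<delta> W) \<cdot>
      (whisker V (l \<cdot> whisker \<one> y W) \<one> \<cdot> whisker \<one> \<delta> W) =
      whisker V l \<one> \<cdot> whisker V (\<mu>H \<cdot> (x \<boxtimes> y) \<cdot> \<Delta>) W \<cdot> whisker \<one> \<delta> W"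
    by (simp add: eqs eqs[THEN comp_prefix_eq] tensor_left_last)
  also have "\<dots> = whisker V (l \<cdot> whisker \<one> \<nu>H W) \<one> \<cdot> whisker \<one> (whisker V \<epsilon> \<one> \<cdot> \<delta>) W"
    unfolding assms(9) by simp
  also have "\<dots> = \<i>\<d> (V \<otimes> W)"
    unfolding unit counit by simp
  finally show ?thesis .
qed

lemma sigma_invertible:
  assumes "hopf_algebra C H \<mu>H \<nu>H \<Delta> \<epsilon>" "right_comodule C H \<Delta> \<epsilon> V \<delta>"
    "left_module C H \<mu>H \<nu>H W l"
  shows "invertible C (\<c> V W \<cdot> (\<i>\<d> V \<boxtimes> l) \<cdot> (\<delta> \<boxtimes> \<i>\<d> W))"
proof -
  have H [simp]: "H \<in> obj C" and str: "\<Delta> \<in> hom C H (H \<otimes> H)" "\<epsilon> \<in> hom C H \<one>" "\<mu>H \<in> hom C (H \<otimes> H) H" "\<nu>H \<in> hom C \<one> H"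
    using assms(1)
    by (auto simp: hopf_algebra_def bialgebra_def unital_algebra_def counital_coalgebra_def)
  have V [simp]: "V \<in> obj C" and \<delta>: "\<delta> \<in> hom C V (V \<otimes> H)"
    and W [simp]: "W \<in> obj C" and l: "l \<in> hom C (H \<otimes> W) W"
    using assms(2,3) by (auto simp: right_comodule_def left_module_def)
  obtain S where S: "S \<in> hom C H H" "\<mu>H \<cdot> (S \<boxtimes> \<i>\<d> H) \<cdot> \<Delta> = \<nu>H \<cdot> \<epsilon>" "\<mu>H \<cdot> (\<i>\<d> H \<boxtimes> S) \<cdot> \<Delta> = \<nu>H \<cdot> \<epsilon>"
    using assms(1) unfolding hopf_algebra_def by blast
  note [simp] = hom_data[OF \<delta>] hom_data[OF l] hom_data[OF S(1)]
  let ?t = "\<lambda>x. whisker V (l \<cdot> whisker \<one> x W) \<one> \<cdot> whisker \<one> \<delta> W"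
  have 1: "?t S \<cdot> ?t (\<i>\<d> H) = \<i>\<d> (V \<otimes> W)"
    by (rule twisted_action_cancel[OF assms(2,3) str S(1) ident_hom[OF H] S(2)])
  have 2: "?t (\<i>\<d> H) \<cdot> ?t S = \<i>\<d> (V \<otimes> W)"
    by (rule twisted_action_cancel[OF assms(2,3) str ident_hom[OF H] S(1) S(3)])
  let ?s = "\<c> V W \<cdot> ?t (\<i>\<d> H)" and ?g = "?t S \<cdot> \<c> W V"
  have "?g \<cdot> ?s = ?t S \<cdot> (\<c> W V \<cdot> \<c> V W) \<cdot> ?t (\<i>\<d> H)" by simp
  also have "\<dots> = \<i>\<d> (V \<otimes> W)" unfolding symm_symm[OF V W] using 1 by simp
  finally have gs: "?g \<cdot> ?s = \<i>\<d> (V \<otimes> W)" .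
  have "?s \<cdot> ?g = \<c> V W \<cdot> (?t (\<i>\<d> H) \<cdot> ?t S) \<cdot> \<c> W V" by simp
  also have "\<dots> = \<i>\<d> (W \<otimes> V)" unfolding 2 by (simp add: symm_symm)
  finally have sg: "?s \<cdot> ?g = \<i>\<d> (W \<otimes> V)" .
  have "?g \<in> hom C (W \<otimes> V) (V \<otimes> W)" by (rule homI) simp_all
  then have "invertible C ?s"
    unfolding invertible_def using gs sg by (intro conjI bexI[of _ ?g]) simp_all
  then show ?thesis by simp
qed

end

theorem theorem5:
  fixes C :: "('o, 'm, 'x) sym_mon_cat_scheme" (structure)
    and H :: 'o and \<mu>H \<nu>H \<Delta>H \<epsilon>H :: 'm
    and r :: nat and V :: "nat \<Rightarrow> 'o" and \<mu> \<nu> lam \<delta> :: "nat \<Rightarrow> 'm"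
    and \<sigma> :: "nat \<Rightarrow> nat \<Rightarrow> 'm"
  assumes "sym_strict_monoidal_category C"
    and "unital_algebra C H \<mu>H \<nu>H"
    and "counital_coalgebra C H \<Delta>H \<epsilon>H"
    and "yd_system C H \<mu>H \<nu>H \<Delta>H \<epsilon>H r V \<mu> \<nu> lam \<delta>"
    and "\<And>i. \<lbrakk>1 \<le> i; i \<le> r\<rbrakk> \<Longrightarrow> \<sigma> i i = \<nu> i \<boxtimes> \<mu> i \<or> \<sigma> i i = \<mu> i \<boxtimes> \<nu> i"
    and "\<And>i j. \<lbrakk>1 \<le> i; i < j; j \<le> r\<rbrakk> \<Longrightarrow>
      \<sigma> i j = \<c> (V i) (V j) \<cdot> (\<i>\<d> (V i) \<boxtimes> lam j) \<cdot> (\<delta> i \<boxtimes> \<i>\<d> (V j))"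
  shows "braided_system C r V \<sigma> \<and>
    (hopf_algebra C H \<mu>H \<nu>H \<Delta>H \<epsilon>H \<longrightarrow>
      (\<forall>i j. 1 \<le> i \<and> i < j \<and> j \<le> r \<longrightarrow> invertible C (\<sigma> i j)))"
proof -
  interpret sym_strict_monoidal_category C by (rule assms(1))
  note diagonal = assms(5) and offdiagonal = assms(6)
  have com: "comodule_algebra C H \<mu>H \<nu>H \<Delta>H \<epsilon>H (V i) (\<mu> i) (\<nu> i) (\<delta> i)" if "1 \<le> i" "i < r" for i
    using assms(4) that by (cases "i = 1") (auto simp: yd_system_def yd_module_algebra_def)
  have mod: "module_algebra C H \<mu>H \<nu>H \<Delta>H \<epsilon>H (V j) (\<mu> j) (\<nu> j) (lam j)" if "1 < j" "j \<le> r" for j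
    using assms(4) that by (cases "j = r") (auto simp: yd_system_def yd_module_algebra_def)
  have yd: "yd_structure C H \<mu>H \<nu>H \<Delta>H \<epsilon>H (V j) (lam j) (\<delta> j)" if "1 < j" "j < r" for j
    using assms(4) that by (auto simp: yd_system_def yd_module_algebra_def)
  have alg: "unital_algebra C (V i) (\<mu> i) (\<nu> i)" if "1 \<le> i" "i \<le> r" for i
    using assms(4) com[of i] mod[of i] that
    by (cases "i = r") (auto simp: yd_system_def comodule_algebra_def module_algebra_def)
  have V [simp]: "V i \<in> obj C" if "1 \<le> i" "i \<le> r" for i
    using alg[OF that] by (simp add: unital_algebra_def)
  have H [simp]: "H \<in> obj C" and \<mu>H: "\<mu>H \<in> hom C (H \<otimes> H) H" and \<Delta>H: "\<Delta>H \<in> hom C H (H \<otimes> H)"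
    using assms(2,3) by (auto simp: unital_algebra_def counital_coalgebra_def)
  have \<delta>: "\<delta> i \<in> hom C (V i) (V i \<otimes> H)" if "1 \<le> i" "i < r" for i
    using com[OF that] by (simp add: comodule_algebra_def right_comodule_def)
  have lam: "lam j \<in> hom C (H \<otimes> V j) (V j)"
    and act: "lam j \<cdot> whisker \<one> \<mu>H (V j) = lam j \<cdot> whisker H (lam j) \<one>" if "1 < j" "j \<le> r" for j
    using mod[OF that] hom_data[OF \<mu>H] that
    by (auto simp: module_algebra_def left_module_def hom_data)
  let ?d = "\<lambda>i. \<c> (V i) H \<cdot> \<delta> i" and ?D = "\<c> H H \<cdot> \<Delta>H"
  have D: "?D \<in> hom C H (H \<otimes> H)" by (rule comp_hom[OF \<Delta>H symm_hom]) simp_all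
  have d: "?d i \<in> hom C (V i) (H \<otimes> V i)" if "1 \<le> i" "i < r" for i
    by (rule comp_hom[OF \<delta>[OF that] symm_hom]) (use that in simp_all)
  have \<sigma>: "\<sigma> i j = pairing H (V i) (V j) (?d i) (lam j)" if "1 \<le> i" "i < j" "j \<le> r" for i j
    using offdiagonal[OF that] sigma_eq_pairing[OF \<delta> lam] that by simp
  have \<sigma>_hom: "\<sigma> i j \<in> hom C (V i \<otimes> V j) (V j \<otimes> V i)" if "1 \<le> i" "i \<le> j" "j \<le> r" for i j
  proof (cases "i = j")
    case True
    have "\<mu> i \<in> hom C (V i \<otimes> V i) (V i)" "\<nu> i \<in> hom C \<one> (V i)"
      using alg[of i] that True by (auto simp: unital_algebra_def)
    then have "\<nu> i \<boxtimes> \<mu> i \<in> hom C (V i \<otimes> V i) (V i \<otimes> V i)"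
      "\<mu> i \<boxtimes> \<nu> i \<in> hom C (V i \<otimes> V i) (V i \<otimes> V i)"
      using tensor_hom[of "\<nu> i" \<one> "V i" "\<mu> i" "V i \<otimes> V i" "V i"]
        tensor_hom[of "\<mu> i" "V i \<otimes> V i" "V i" "\<nu> i" \<one> "V i"] that True by simp_all
    then show ?thesis using diagonal[of i] that True by auto
  next
    case False
    then show ?thesis
      using pairing_hom[OF H _ _ d lam, of i j] that by (simp add: \<sigma>)
  qed
  have ybe: "whisker \<one> (\<sigma> j k) (V i) \<cdot> whisker (V j) (\<sigma> i k) \<one> \<cdot> whisker \<one> (\<sigma> i j) (V k) =
      whisker (V k) (\<sigma> i j) \<one> \<cdot> whisker \<one> (\<sigma> i k) (V j) \<cdot> whisker (V i) (\<sigma> j k) \<one>"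
    if ijk: "1 \<le> i" "i \<le> j" "j \<le> k" "k \<le> r" for i j k
  proof -
    consider "i = j" "j = k" | "i = j" "j < k" | "i < j"
      using ijk by linarith
    then show ?thesis
    proof cases
      case 1
      then show ?thesis
        using yang_baxter_algebra[OF alg diagonal, of i] ijk by simp
    next
      case 2
      have "codiag_coaction H \<mu>H (V i) (V i) (?d i) (?d i) \<cdot> \<sigma> i i =
          whisker H (\<sigma> i i) \<one> \<cdot> codiag_coaction H \<mu>H (V i) (V i) (?d i) (?d i)"
        using comodule_algebra_colinear[OF assms(2) com diagonal, of i] ijk 2 by simp
      from yang_baxter_if_colinear[OF \<mu>H lam act d d \<sigma>_hom this, of k]
      show ?thesis using ijk 2 by (simp add: \<sigma>)
    next
      case 3
      have "diag_action H ?D (V k) (V j) (lam k) (lam j) \<cdot> whisker H (\<sigma> j k) \<one> =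
          \<sigma> j k \<cdot> diag_action H ?D (V j) (V k) (lam j) (lam k)"
      proof (cases "j = k")
        case True
        then show ?thesis
          using module_algebra_linear[OF assms(3) mod diagonal, of j] ijk 3 by simp
      next
        case False
        then have "1 < j" "j < r" "1 < k" using ijk 3 by simp_all
        then show ?thesis
          using pairing_linear_if_yd[OF D \<mu>H d lam lam act yd_structure_op[OF \<Delta>H \<mu>H yd], of j k]
            ijk False by (simp add: \<sigma>)
      qed
      moreover have "whisker H (?d i) \<one> \<cdot> ?d i = whisker \<one> ?D (V i) \<cdot> ?d i"
        using comodule_op_coassoc[OF \<Delta>H, of \<epsilon>H "V i" "\<delta> i"] com[of i] ijk 3
        by (simp add: comodule_algebra_def)
      ultimately show ?thesis
        using yang_baxter_if_linear[OF D d _ lam lam \<sigma>_hom, of i j k] ijk 3 by (simp add: \<sigma>)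
    qed
  qed
  have "braided_system C r V \<sigma>"
    unfolding braided_system_def
  proof (intro conjI allI impI; (elim conjE)?)
    fix i j k assume ijk: "1 \<le> i" "i \<le> j" "j \<le> k" "k \<le> r"
    then have "\<sigma> i j \<in> arr C" "\<sigma> j k \<in> arr C" "\<sigma> i k \<in> arr C"
      using \<sigma>_hom[of i j] \<sigma>_hom[of j k] \<sigma>_hom[of i k] by (auto simp: hom_def)
    then show "(\<sigma> j k \<boxtimes> \<i>\<d> (V i)) \<cdot> (\<i>\<d> (V j) \<boxtimes> \<sigma> i k) \<cdot> (\<sigma> i j \<boxtimes> \<i>\<d> (V k)) =
        (\<i>\<d> (V k) \<boxtimes> \<sigma> i j) \<cdot> (\<sigma> i k \<boxtimes> \<i>\<d> (V j)) \<cdot> (\<i>\<d> (V i) \<boxtimes> \<sigma> j k)"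
      using ybe[OF ijk] ijk by simp
  qed (use \<sigma>_hom in simp_all)
  moreover have "invertible C (\<sigma> i j)"
    if "hopf_algebra C H \<mu>H \<nu>H \<Delta>H \<epsilon>H" "1 \<le> i" "i < j" "j \<le> r" for i j
    using sigma_invertible[OF that(1), of "V i" "\<delta> i" "V j" "lam j"] com[of i] mod[of j] that
    by (simp only: offdiagonal) (simp add: comodule_algebra_def module_algebra_def)
  ultimately show ?thesis by blast
qed

end
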